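(* Deterministic strongly convex case. Assume (A1)--(A3) of the context, $\mu>0$, and that exact gradients and Hessian/Jacobian-vector products are used (all variances are zero), with all batches of size $1$. Run AmIGO with $\alpha_k=L_g^{-1}$, $\beta_k=(2L_g)^{-1}$, $\gamma_k=L^{-1}$ and numbers of inner iterations $T,N$ as given in the context (both $O(\kappa_g)$ up to logarithmic factors). Then for every $\epsilon>0$ AmIGO achieves $\mathcal L(x_k)-\mathcal L^\star+\frac\mu2\|x_k-x^\star\|^2\le\epsilon$ with complexity $$\mathcal C(\epsilon)=O\Big(\kappa_{\mathcal L}\,\kappa_g\,\log\Big(\frac{E_0^{tot}}{\epsilon}\Big)\Big),$$ where $O$ treats $L_f,B,L_g,L_g',M_g$ as fixed constants and suppresses factors logarithmic in the condition numbers.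
   Context: **Problem.** $\mathcal X=\mathbb R^{d_x}$, $\mathcal Y=\mathbb R^{d_y}$; $f,g:\mathcal X\times\mathcal Y\to\mathbb R$, $f$ differentiable, $g$ twice differentiable; $\partial_{xy}g(x,y)$ is the $d_x\times d_y$ matrix with entries $\partial^2g/\partial x_i\partial y_j$. $y^\star(x)=\arg\min_yg(x,y)$, $z^\star(x,y)=-\partial_{yy}g(x,y)^{-1}\partial_yf(x,y)$, $\mathcal L(x)=f(x,y^\star(x))$. **Assumptions.** (A1) For every $x$, $y\mapsto g(x,y)$ is $L_g$-smooth and $\mu_g$-strongly convex ($\mu_g>0$); $\kappa_g=L_g/\mu_g$. (A2) $\nabla f$ is $L_f$-Lipschitz and $\|\partial_yf\|\le B$. (A3) $\partial_{xy}g,\partial_{yy}g$ are $M_g$-Lipschitz in $(x,y)$; $\|\partial_yg(x,y)-\partial_yg(x',y)\|\le L_g'\|x-x'\|$. **Constants.** $L_y=\mu_g^{-1}L_g'$, $L_z=\mu_g^{-2}M_gB+\mu_g^{-1}L_f$, $L_\psi=\max(L_f+M_g\mu_g^{-1}B+L_g'L_z,L_g')$, $L=(L_f+\mu_g^{-2}L_g'M_gB+\mu_g^{-1}(L_g'L_f+M_gB))(1+\mu_g^{-1}L_g')$ ($\mathcal L$ is $L$-smooth). $\mathcal L$ is $\mu$-strongly convex, $0<\mu\le L$, with minimizer $x^\star$ and minimum $\mathcal L^\star$; $\kappa_{\mathcal L}=L/\mu$. **AmIGO (deterministic).** Given $x_0,y_{-1},z_{-1}$, for $k\ge0$: $y_k$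 is obtained from $y_k^0=y_{k-1}$ by $T$ steps $y\leftarrow y-\alpha_k\partial_yg(x_k,y)$; $v_k=\partial_yf(x_k,y_k)$; $z_k$ is obtained from $z_k^0=z_{k-1}$ by $N$ steps $z\leftarrow z-\beta_k(\partial_{yy}g(x_k,y_k)z+v_k)$; $\hat\psi_k=\partial_xf(x_k,y_k)+\partial_{xy}g(x_k,y_k)z_k$; $x_{k+1}=x_k-\gamma_{k+1}\hat\psi_k$. **Complexity.** $\mathcal C(\epsilon)$ is the total number of gradient evaluations of $f,g$ and Jacobian/Hessian-vector products: $\mathcal C(\epsilon)=k(T|\mathcal D_g|+N|\mathcal D_{g_{yy}}|+|\mathcal D_{g_{xy}}|+|\mathcal D_f|)$, with all batch sizes equal to 1 here and $k$ the number of outer iterations used. **Choice of $T,N$.** With $\eta_0=\mu$, $\gamma=L^{-1}$, $\alpha=L_g^{-1}$, $\beta=(2L_g)^{-1}$, $\zeta_0=2L$: $T=\lfloor\alpha^{-1}\mu_g^{-1}\max(C_1,C_2,C_3)\rfloor+1$, $N=\lfloor2\beta^{-1}\mu_g^{-1}(\max(C_1,C_2,C_3)+\max(C_1',C_2',C_3'))\rfloor+1$, where $C_1=1+2\log(6+24L_\psi^2\eta_0^{-1})$, $C_2=2\log(1+4L_y^2L^{-2}\max(\eta_0,8\zeta_0))$, $C_3=\max(0,-2\log(5L_\psi^2\eta_0^{-1}),-2\log\frac L{4L_y^2})$, $C_1'=1+2\log(4+24\eta_0^{-1}L_\psi^2)$, $C_2'=2\log(1+2L_z^2L_y^{-2}(1+16L_y^2))$,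 $C_3'=\max(0,-2\log\frac{L_\psi^2}{4L_z^2\eta_0},-2\log(\gamma(L_g')^2))$. **Initial error.** $E_0^{tot}=\frac\mu2\|x_0-x^\star\|^2+\mathcal L(x_0)-\mathcal L^\star+a_0\|y_{-1}-y^\star(x_0)\|^2+b_0\|z_{-1}-z^\star(x_0,y_0)\|^2$ with $a_0=\delta_0(1-\alpha\mu_g)^{T/2}$, $b_0=\delta_0(1-\frac12\beta\mu_g)^{N/2}$, $\delta_0=\mu/L$. *)

theory Defs
  imports "HOL-Analysis.Analysis"
begin

definition gradient :: "('a::euclidean_space \<Rightarrow> real) \<Rightarrow> 'a \<Rightarrow> 'a" where
  "gradient F x = (THE D. GDERIV F x :> D)"

definition twice_differentiable :: "('a::euclidean_space \<Rightarrow> real) \<Rightarrow> bool" where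
  "twice_differentiable F \<longleftrightarrow>
     F differentiable_on UNIV \<and> gradient F differentiable_on UNIV"

definition strongly_convex :: "real \<Rightarrow> ('a::real_inner \<Rightarrow> real) \<Rightarrow> bool" where
  "strongly_convex m F \<longleftrightarrow>
     (\<forall>u v. \<forall>t\<in>{0..1}. F (t *\<^sub>R u + (1 - t) *\<^sub>R v)
        \<le> t * F u + (1 - t) * F v - m / 2 * t * (1 - t) * (norm (u - v))\<^sup>2)"

definition smooth :: "real \<Rightarrow> ('a::euclidean_space \<Rightarrow> real) \<Rightarrow> bool" where
  "smooth l F \<longleftrightarrow> F differentiable_on UNIV \<and> l-lipschitz_on UNIV (gradient F)"

definition grad_x :: "('a::euclidean_space \<times> 'b::euclidean_space \<Rightarrow> real) \<Rightarrow> 'a \<Rightarrow> 'b \<Rightarrow> 'a" where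
  "grad_x F x y = gradient (\<lambda>u. F (u, y)) x"

definition grad_y :: "('a::euclidean_space \<times> 'b::euclidean_space \<Rightarrow> real) \<Rightarrow> 'a \<Rightarrow> 'b \<Rightarrow> 'b" where
  "grad_y F x y = gradient (\<lambda>v. F (x, v)) y"

text \<open>The library's \<^const>\<open>jacobian\<close> of \<open>u \<mapsto> grad_y F u y\<close> has the entry
  \<open>\<partial>/\<partial>x\<^sub>j (\<partial>F/\<partial>y\<^sub>i)\<close> in row \<open>i\<close> and column \<open>j\<close>;
  its transpose is the matrix with rows indexed by \<open>x\<close> and columns indexed by \<open>y\<close>.\<close>

definition hess_xy :: "((real^'m) \<times> (real^'n) \<Rightarrow> real) \<Rightarrow> real^'m \<Rightarrow> real^'n \<Rightarrow> real^'n^'m" where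
  "hess_xy F x y = transpose (jacobian (\<lambda>u. grad_y F u y) (at x))"

definition hess_yy :: "((real^'m) \<times> (real^'n) \<Rightarrow> real) \<Rightarrow> real^'m \<Rightarrow> real^'n \<Rightarrow> real^'n^'n" where
  "hess_yy F x y = jacobian (grad_y F x) (at y)"

text \<open>Lipschitz continuity of a matrix field in the operator norm
  (\<^const>\<open>norm\<close> on matrices is the Frobenius norm).\<close>

definition op_lipschitz ::
    "real \<Rightarrow> (real^'m \<Rightarrow> real^'n \<Rightarrow> real^'q^'p) \<Rightarrow> bool" where
  "op_lipschitz M A \<longleftrightarrow>
     (\<forall>x y x' y'. onorm (\<lambda>v. (A x y - A x' y') *v v) \<le> M * dist (x, y) (x', y'))"

definition y_star :: "((real^'m) \<times> (real^'n) \<Rightarrow> real) \<Rightarrow> real^'m \<Rightarrow> real^'n" where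
  "y_star g x = arg_min (\<lambda>y. g (x, y)) (\<lambda>_. True)"

definition z_star ::
    "((real^'m) \<times> (real^'n) \<Rightarrow> real) \<Rightarrow> ((real^'m) \<times> (real^'n) \<Rightarrow> real)
      \<Rightarrow> real^'m \<Rightarrow> real^'n \<Rightarrow> real^'n" where
  "z_star f g x y = - (matrix_inv (hess_yy g x y) *v grad_y f x y)"

definition outer_obj ::
    "((real^'m) \<times> (real^'n) \<Rightarrow> real) \<Rightarrow> ((real^'m) \<times> (real^'n) \<Rightarrow> real)
      \<Rightarrow> real^'m \<Rightarrow> real" where
  "outer_obj f g x = f (x, y_star g x)"

definition x_star ::
    "((real^'m) \<times> (real^'n) \<Rightarrow> real) \<Rightarrow> ((real^'m) \<times> (real^'n) \<Rightarrow> real) \<Rightarrow> real^'m" where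
  "x_star f g = arg_min (outer_obj f g) (\<lambda>_. True)"

definition assm_A1 :: "((real^'m) \<times> (real^'n) \<Rightarrow> real) \<Rightarrow> real \<Rightarrow> real \<Rightarrow> bool" where
  "assm_A1 g Lg mug \<longleftrightarrow>
     0 < mug \<and> (\<forall>x. smooth Lg (\<lambda>y. g (x, y)) \<and> strongly_convex mug (\<lambda>y. g (x, y)))"

definition assm_A2 :: "((real^'m) \<times> (real^'n) \<Rightarrow> real) \<Rightarrow> real \<Rightarrow> real \<Rightarrow> bool" where
  "assm_A2 f Lf B \<longleftrightarrow>
     Lf-lipschitz_on UNIV (gradient f) \<and> (\<forall>x y. norm (grad_y f x y) \<le> B)"

definition assm_A3 :: "((real^'m) \<times> (real^'n) \<Rightarrow> real) \<Rightarrow> real \<Rightarrow> real \<Rightarrow> bool" where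
  "assm_A3 g Mg Lg' \<longleftrightarrow>
     op_lipschitz Mg (hess_xy g) \<and> op_lipschitz Mg (hess_yy g) \<and>
     (\<forall>x x' y. norm (grad_y g x y - grad_y g x' y) \<le> Lg' * norm (x - x'))"

text \<open>The parameters \<open>Lf B Lg Lg' Mg mug mu\<close> stand for
  \<open>L\<^sub>f, B, L\<^sub>g, L\<^sub>g', M\<^sub>g, \<mu>\<^sub>g, \<mu>\<close> and always occur in this order.\<close>

definition const_Ly :: "real \<Rightarrow> real \<Rightarrow> real" where
  "const_Ly Lg' mug = Lg' / mug"

definition const_Lz :: "real \<Rightarrow> real \<Rightarrow> real \<Rightarrow> real \<Rightarrow> real" where
  "const_Lz Lf B Mg mug = Mg * B / mug\<^sup>2 + Lf / mug"

definition const_Lpsi :: "real \<Rightarrow> real \<Rightarrow> real \<Rightarrow> real \<Rightarrow> real \<Rightarrow> real" where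
  "const_Lpsi Lf B Lg' Mg mug =
     max (Lf + Mg * B / mug + Lg' * const_Lz Lf B Mg mug) Lg'"

definition const_L :: "real \<Rightarrow> real \<Rightarrow> real \<Rightarrow> real \<Rightarrow> real \<Rightarrow> real" where
  "const_L Lf B Lg' Mg mug =
     (Lf + Lg' * Mg * B / mug\<^sup>2 + (Lg' * Lf + Mg * B) / mug) * (1 + Lg' / mug)"

definition max_C ::
    "real \<Rightarrow> real \<Rightarrow> real \<Rightarrow> real \<Rightarrow> real \<Rightarrow> real \<Rightarrow> real" where
  "max_C Lf B Lg' Mg mug mu =
    (let Ly = const_Ly Lg' mug; Lpsi = const_Lpsi Lf B Lg' Mg mug;
         L = const_L Lf B Lg' Mg mug; eta0 = mu; zeta0 = 2 * L;
         C1 = 1 + 2 * ln (6 + 24 * Lpsi\<^sup>2 / eta0);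
         C2 = 2 * ln (1 + 4 * Ly\<^sup>2 / L\<^sup>2 * max eta0 (8 * zeta0));
         C3 = Max {0, - 2 * ln (5 * Lpsi\<^sup>2 / eta0), - 2 * ln (L / (4 * Ly\<^sup>2))}
     in Max {C1, C2, C3})"

definition max_C' ::
    "real \<Rightarrow> real \<Rightarrow> real \<Rightarrow> real \<Rightarrow> real \<Rightarrow> real \<Rightarrow> real" where
  "max_C' Lf B Lg' Mg mug mu =
    (let Ly = const_Ly Lg' mug; Lz = const_Lz Lf B Mg mug;
         Lpsi = const_Lpsi Lf B Lg' Mg mug;
         L = const_L Lf B Lg' Mg mug; eta0 = mu; gamma = 1 / L;
         C1' = 1 + 2 * ln (4 + 24 * Lpsi\<^sup>2 / eta0);
         C2' = 2 * ln (1 + 2 * Lz\<^sup>2 / Ly\<^sup>2 * (1 + 16 * Ly\<^sup>2));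
         C3' = Max {0, - 2 * ln (Lpsi\<^sup>2 / (4 * Lz\<^sup>2 * eta0)), - 2 * ln (gamma * Lg'\<^sup>2)}
     in Max {C1', C2', C3'})"

definition num_T ::
    "real \<Rightarrow> real \<Rightarrow> real \<Rightarrow> real \<Rightarrow> real \<Rightarrow> real \<Rightarrow> real \<Rightarrow> nat" where
  "num_T Lf B Lg Lg' Mg mug mu =
    (let alpha = 1 / Lg
     in nat \<lfloor>1 / alpha * (1 / mug) * max_C Lf B Lg' Mg mug mu\<rfloor> + 1)"

definition num_N ::
    "real \<Rightarrow> real \<Rightarrow> real \<Rightarrow> real \<Rightarrow> real \<Rightarrow> real \<Rightarrow> real \<Rightarrow> nat" where
  "num_N Lf B Lg Lg' Mg mug mu =
    (let beta = 1 / (2 * Lg)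
     in nat \<lfloor>2 * (1 / beta) * (1 / mug) *
          (max_C Lf B Lg' Mg mug mu + max_C' Lf B Lg' Mg mug mu)\<rfloor> + 1)"

definition inner_y ::
    "((real^'m) \<times> (real^'n) \<Rightarrow> real) \<Rightarrow> real \<Rightarrow> nat \<Rightarrow> real^'m \<Rightarrow> real^'n \<Rightarrow> real^'n" where
  "inner_y g a T x = ((\<lambda>y. y - a *\<^sub>R grad_y g x y) ^^ T)"

definition inner_z ::
    "((real^'m) \<times> (real^'n) \<Rightarrow> real) \<Rightarrow> real \<Rightarrow> nat \<Rightarrow> real^'m \<Rightarrow> real^'n \<Rightarrow> real^'n
      \<Rightarrow> real^'n \<Rightarrow> real^'n" where
  "inner_z g b N x y v = ((\<lambda>z. z - b *\<^sub>R (hess_yy g x y *v z + v)) ^^ N)"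

text \<open>The state with index \<open>k\<close> is \<open>(x\<^sub>k, y\<^sub>k\<^sub>-\<^sub>1, z\<^sub>k\<^sub>-\<^sub>1)\<close>,
  so that the warm starts \<open>y\<^sub>-\<^sub>1\<close> and \<open>z\<^sub>-\<^sub>1\<close> belong to the initial state.\<close>

primrec amigo ::
    "((real^'m) \<times> (real^'n) \<Rightarrow> real) \<Rightarrow> ((real^'m) \<times> (real^'n) \<Rightarrow> real)
      \<Rightarrow> (nat \<Rightarrow> real) \<Rightarrow> (nat \<Rightarrow> real) \<Rightarrow> (nat \<Rightarrow> real) \<Rightarrow> nat \<Rightarrow> nat
      \<Rightarrow> real^'m \<Rightarrow> real^'n \<Rightarrow> real^'n \<Rightarrow> nat \<Rightarrow> (real^'m) \<times> (real^'n) \<times> (real^'n)" where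
  "amigo f g alpha beta gamma T N x0 ym zm 0 = (x0, ym, zm)"
| "amigo f g alpha beta gamma T N x0 ym zm (Suc k) =
    (case amigo f g alpha beta gamma T N x0 ym zm k of (x, yprev, zprev) \<Rightarrow>
      let y = inner_y g (alpha k) T x yprev;
          v = grad_y f x y;
          z = inner_z g (beta k) N x y v zprev;
          psi = grad_x f x y + hess_xy g x y *v z
      in (x - gamma (Suc k) *\<^sub>R psi, y, z))"

definition complexity :: "nat \<Rightarrow> nat \<Rightarrow> nat \<Rightarrow> nat \<Rightarrow> nat \<Rightarrow> nat \<Rightarrow> nat \<Rightarrow> nat" where
  "complexity T N Dg Dgyy Dgxy Df k = k * (T * Dg + N * Dgyy + Dgxy + Df)"

definition E0_tot ::
    "((real^'m) \<times> (real^'n) \<Rightarrow> real) \<Rightarrow> ((real^'m) \<times> (real^'n) \<Rightarrow> real)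
      \<Rightarrow> real \<Rightarrow> real \<Rightarrow> real \<Rightarrow> real \<Rightarrow> real \<Rightarrow> real \<Rightarrow> real
      \<Rightarrow> real^'m \<Rightarrow> real^'n \<Rightarrow> real^'n \<Rightarrow> real" where
  "E0_tot f g Lf B Lg Lg' Mg mug mu x0 ym zm =
    (let T = num_T Lf B Lg Lg' Mg mug mu; N = num_N Lf B Lg Lg' Mg mug mu;
         alpha = 1 / Lg; beta = 1 / (2 * Lg);
         delta0 = mu / const_L Lf B Lg' Mg mug;
         a0 = delta0 * (1 - alpha * mug) powr (real T / 2);
         b0 = delta0 * (1 - 1 / 2 * beta * mug) powr (real N / 2);
         y0 = inner_y g alpha T x0 ym
     in mu / 2 * (norm (x0 - x_star f g))\<^sup>2
        + outer_obj f g x0 - outer_obj f g (x_star f g)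
        + a0 * (norm (ym - y_star g x0))\<^sup>2
        + b0 * (norm (zm - z_star f g x0 y0))\<^sup>2)"

end

theory Submission
  imports Defs
begin

text \<open>One outer step is a gradient step on \<open>outer_obj f g\<close> whose error is controlled by the distances
  of the inner iterates to \<open>y\<^sup>\<star>\<close> and \<open>z\<^sup>\<star>\<close>. These distances contract geometrically in the inner
  loops and drift by an amount proportional to the outer step when the targets move. For the
  prescribed \<open>T\<close> and \<open>N\<close>, the potential
  \<open>F x - F x\<^sup>\<star> + a * \<parallel>y - y\<^sup>\<star>\<parallel>\<^sup>2 + b * \<parallel>z - z\<^sup>\<star>\<parallel>\<^sup>2\<close> with \<open>F = outer_obj f g\<close> and the weights
  \<open>a = a\<^sub>0\<close>, \<open>b = b\<^sub>0\<close> of the initial error decreases by the factor \<open>1 - mu / (2 * L)\<close> in each outer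
  step, and twice the potential dominates the error. The logarithms in \<open>T\<close> and \<open>N\<close> have
  arguments that grow at most polynomially in \<open>\<kappa>\<^sub>L * \<kappa>\<^sub>g\<close>.\<close>

section \<open>Smooth and strongly convex functions\<close>

text \<open>The square roots in \<open>a\<close> and \<open>b\<close> reconcile two opposite
  demands. A weight must be so small that a moving target costs only part of the descent of
  \<open>F\<close>, and so large that it pays for the error which the inner iterate causes in the
  hypergradient. The inner loop leaves the fraction \<open>q\<close> of a squared error while the
  weight is only of order \<open>sqrt q\<close>, so one factor \<open>sqrt q\<close> remains to beat
  the constants. The entries \<open>C1\<close>, \<open>C2\<close>, ... encode exactly these
  smallness conditions. The analytic obstacle is that \<open>y_star\<close> is given by choice and
  \<open>outer_obj\<close> through it: existence of minimizers, differentiability of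
  \<open>y_star\<close>, the hypergradient formula and the smoothness constant \<open>L\<close> all
  have to be derived. For a constant uniform in \<open>mug\<close> and \<open>mu\<close>, upper
  bounds on the constants do not suffice: some logarithms enter negatively, so \<open>L\<close>,
  \<open>Ly\<close> and \<open>Lpsi\<close> must also be bounded from below.\<close>

lemma power2_norm_diff_scaleR:
  fixes e w :: "'a::real_inner"
  shows "(norm (e - c *\<^sub>R w))\<^sup>2 = (norm e)\<^sup>2 - 2 * c * (e \<bullet> w) + c\<^sup>2 * (norm w)\<^sup>2"
  unfolding power2_norm_eq_inner
  by (simp add: inner_diff_left inner_diff_right inner_commute power2_eq_square algebra_simps)

section \<open>Gradients and the quadratic upper bound\<close>

lemma gradient_eqI:
  assumes "GDERIV F x :> D"
  shows "gradient F x = D"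
  unfolding gradient_def
proof (rule the_equality, rule assms)
  fix D' assume "GDERIV F x :> D'"
  from has_derivative_unique[OF this[unfolded gderiv_def] assms[unfolded gderiv_def]]
  have "\<forall>h. h \<bullet> D' = h \<bullet> D"
    unfolding fun_eq_iff .
  then show "D' = D"
    by (rule vector_eq_ldot[THEN iffD1])
qed

lemma GDERIV_gradient:
  fixes F :: "'a::euclidean_space \<Rightarrow> real"
  assumes "F differentiable (at x)"
  shows "GDERIV F x :> gradient F x"
proof -
  obtain F' where F': "(F has_derivative F') (at x)"
    using assms unfolding differentiable_def by blast
  then have "F' = (\<lambda>h. h \<bullet> adjoint F' 1)"
    by (simp add: adjoint_works has_derivative_linear)
  then have "GDERIV F x :> adjoint F' 1"
    using F' unfolding gderiv_def by simp
  then show ?thesis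
    by (metis gradient_eqI)
qed

lemma GDERIV_along_line:
  assumes "GDERIV F (x + t *\<^sub>R d) :> D"
  shows "((\<lambda>t. F (x + t *\<^sub>R d)) has_real_derivative d \<bullet> D) (at t)"
proof -
  have "((\<lambda>t. F (x + t *\<^sub>R d)) has_derivative (\<lambda>h. (h *\<^sub>R d) \<bullet> D)) (at t)"
    by (rule has_derivative_compose[where f = "\<lambda>t. x + t *\<^sub>R d"])
      (use assms in \<open>auto simp: gderiv_def intro!: derivative_eq_intros\<close>)
  then show ?thesis
    by (simp add: has_field_derivative_def mult_commute_abs)
qed

lemma smooth_descent:
  assumes "smooth l F"
  shows "F (x + d) \<le> F x + d \<bullet> gradient F x + l / 2 * (norm d)\<^sup>2"
proof -
  \<comment> \<open>With the quadratic model subtracted, the claim becomes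
    \<open>\<phi> 1 \<le> \<phi> 0\<close>.\<close>
  define \<phi> where "\<phi> t = F (x + t *\<^sub>R d) - t * (d \<bullet> gradient F x) - l / 2 * t\<^sup>2 * (norm d)\<^sup>2" for t
  have diff: "F differentiable (at u)" for u
    using assms unfolding smooth_def differentiable_on_def by simp
  have lip: "norm (gradient F u - gradient F v) \<le> l * norm (u - v)" for u v
    using assms lipschitz_onD[of l UNIV "gradient F" u v] unfolding smooth_def dist_norm by blast
  have "\<phi> 1 \<le> \<phi> 0"
  proof (rule DERIV_nonpos_imp_nonincreasing[where f = \<phi> and a = 0 and b = 1])
    fix t :: real assume t: "0 \<le> t" "t \<le> 1"
    let ?D = "d \<bullet> (gradient F (x + t *\<^sub>R d) - gradient F x) - l * t * (norm d)\<^sup>2"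
    have "(\<phi> has_real_derivative ?D) (at t)"
      unfolding \<phi>_def
      by (auto intro!: derivative_eq_intros GDERIV_along_line GDERIV_gradient diff
          simp: inner_diff_right)
    moreover have "d \<bullet> (gradient F (x + t *\<^sub>R d) - gradient F x) \<le> norm d * (l * norm (t *\<^sub>R d))"
      using lip[of "x + t *\<^sub>R d" x]
      by (intro order_trans[OF norm_cauchy_schwarz] mult_left_mono) auto
    then have "?D \<le> 0"
      using t by (simp add: power2_eq_square algebra_simps)
    ultimately show "\<exists>D. (\<phi> has_real_derivative D) (at t) \<and> D \<le> 0"
      by blast
  qed simp
  then show ?thesis
    by (simp add: \<phi>_def)
qed

text \<open>Compare the minimum with the value after a step of length \<open>1 / l\<close>, which
  minimizes the quadratic upper bound.\<close>

lemma smooth_gradient_norm_le: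
  assumes "smooth l F" "l > 0" "\<And>u. F v \<le> F u"
  shows "(norm (gradient F x))\<^sup>2 \<le> 2 * l * (F x - F v)"
proof -
  let ?D = "gradient F x"
  have "F v \<le> F (x + (- (1 / l)) *\<^sub>R ?D)"
    using assms(3) .
  also have "\<dots> \<le> F x + ((- (1 / l)) *\<^sub>R ?D) \<bullet> ?D + l / 2 * (norm ((- (1 / l)) *\<^sub>R ?D))\<^sup>2"
    by (rule smooth_descent[OF assms(1)])
  also have "\<dots> = F x - 1 / (2 * l) * (norm ?D)\<^sup>2"
  proof -
    have "l / 2 * (norm ((- (1 / l)) *\<^sub>R ?D))\<^sup>2 = 1 / (2 * l) * (norm ?D)\<^sup>2"
      using \<open>l > 0\<close> by (simp add: power_divide power2_eq_square[of l])
    then show ?thesis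
      by (simp add: power2_norm_eq_inner)
  qed
  finally show ?thesis
    using \<open>l > 0\<close> by (simp add: field_simps)
qed

section \<open>One-sided derivatives and strong convexity\<close>

lemma directional_derivative_tendsto:
  assumes "(G has_derivative H) (at y)"
  shows "((\<lambda>t. (G (y + t *\<^sub>R h) - G y) /\<^sub>R t) \<longlongrightarrow> H h) (at_right 0)"
proof -
  have "((\<lambda>t. G (y + t *\<^sub>R h)) has_derivative (\<lambda>s. H (s *\<^sub>R h))) (at 0)"
    by (rule has_derivative_compose[where f = "\<lambda>t. y + t *\<^sub>R h"])
      (use assms in \<open>auto intro!: derivative_eq_intros\<close>)
  from has_derivative_at_withinI[OF this, of "{0<..}"]
  have "((\<lambda>t. (G (y + t *\<^sub>R h) - G y - t *\<^sub>R H h) /\<^sub>R norm t) \<longlongrightarrow> 0) (at_right 0)"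
    by (simp add: has_derivative_at_within linear_cmul[OF has_derivative_linear[OF assms]])
  then have "((\<lambda>t. (G (y + t *\<^sub>R h) - G y - t *\<^sub>R H h) /\<^sub>R norm t + H h) \<longlongrightarrow> 0 + H h) (at_right 0)"
    by (intro tendsto_add tendsto_const)
  moreover have "\<forall>\<^sub>F t in at_right 0. (G (y + t *\<^sub>R h) - G y - t *\<^sub>R H h) /\<^sub>R norm t + H h
      = (G (y + t *\<^sub>R h) - G y) /\<^sub>R t"
    by (rule eventually_at_rightI[of 0 1]) (auto simp: scaleR_diff_right)
  ultimately show ?thesis
    using Lim_transform_eventually by force
qed

text \<open>Divide the convexity inequality on the segment from \<open>x\<close> to \<open>u\<close>
  by \<open>t\<close> and let \<open>t\<close> tend to 0 from the right.\<close>

lemma strongly_convex_above_tangent: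
  assumes "strongly_convex m F" "GDERIV F x :> D"
  shows "F x + (u - x) \<bullet> D + m / 2 * (norm (u - x))\<^sup>2 \<le> F u"
proof -
  have "(u - x) \<bullet> D \<le> F u - F x - m / 2 * (1 - 0) * (norm (u - x))\<^sup>2"
  proof (rule tendsto_le)
    show "((\<lambda>t. F u - F x - m / 2 * (1 - t) * (norm (u - x))\<^sup>2)
        \<longlongrightarrow> F u - F x - m / 2 * (1 - 0) * (norm (u - x))\<^sup>2) (at_right 0)"
      by (intro tendsto_intros)
    show "((\<lambda>t. (F (x + t *\<^sub>R (u - x)) - F x) /\<^sub>R t) \<longlongrightarrow> (u - x) \<bullet> D) (at_right 0)"
      using directional_derivative_tendsto[OF assms(2)[unfolded gderiv_def]] .
    show "\<forall>\<^sub>F t in at_right 0. (F (x + t *\<^sub>R (u - x)) - F x) /\<^sub>R t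
        \<le> F u - F x - m / 2 * (1 - t) * (norm (u - x))\<^sup>2"
    proof (rule eventually_at_rightI[of 0 1])
      fix t :: real assume t: "t \<in> {0<..<1}"
      have "F (t *\<^sub>R u + (1 - t) *\<^sub>R x)
          \<le> t * F u + (1 - t) * F x - m / 2 * t * (1 - t) * (norm (u - x))\<^sup>2"
        using assms(1) t unfolding strongly_convex_def by auto
      moreover have "t *\<^sub>R u + (1 - t) *\<^sub>R x = x + t *\<^sub>R (u - x)"
        by (simp add: algebra_simps)
      ultimately have "F (x + t *\<^sub>R (u - x)) - F x
          \<le> t * (F u - F x - m / 2 * (1 - t) * (norm (u - x))\<^sup>2)"
        by (simp add: algebra_simps)
      then show "(F (x + t *\<^sub>R (u - x)) - F x) /\<^sub>R t
          \<le> F u - F x - m / 2 * (1 - t) * (norm (u - x))\<^sup>2"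
        using t by (simp add: field_simps)
    qed simp
  qed simp
  then show ?thesis
    by simp
qed

text \<open>The Polyak-Lojasiewicz inequality, obtained by completing the square in the tangent
  bound.\<close>

lemma strongly_convex_gradient_norm_ge:
  assumes "strongly_convex m F" "GDERIV F x :> D" "m > 0"
  shows "2 * m * (F x - F u) \<le> (norm D)\<^sup>2"
proof -
  let ?w = "u - x"
  have "0 \<le> (norm (D + m *\<^sub>R ?w))\<^sup>2"
    by simp
  also have "\<dots> = (norm D)\<^sup>2 + 2 * m * (?w \<bullet> D) + m\<^sup>2 * (norm ?w)\<^sup>2"
    using power2_norm_diff_scaleR[of D "- m" ?w] by (simp add: inner_commute)
  also have "\<dots> = (norm D)\<^sup>2 + 2 * m * (?w \<bullet> D + m / 2 * (norm ?w)\<^sup>2)"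
    by (simp add: power2_eq_square algebra_simps)
  also have "\<dots> \<le> (norm D)\<^sup>2 + 2 * m * (F u - F x)"
    using strongly_convex_above_tangent[OF assms(1,2), of u] \<open>m > 0\<close>
    by (intro add_left_mono mult_left_mono) auto
  finally show ?thesis
    by (simp add: algebra_simps)
qed

lemma strongly_convex_gradient_monotone:
  assumes "strongly_convex m F" "GDERIV F x :> D" "GDERIV F y :> E"
  shows "m * (norm (x - y))\<^sup>2 \<le> (x - y) \<bullet> (D - E)"
  using strongly_convex_above_tangent[OF assms(1,2), of y]
    strongly_convex_above_tangent[OF assms(1,3), of x]
  by (simp add: inner_diff_left inner_diff_right norm_minus_commute[of y x])

text \<open>\<open>arg_min\<close> is a choice operator, so it says something only once a minimizer
  exists. Coercivity provides one in a compact ball.\<close>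

lemma strongly_convex_arg_min:
  fixes F :: "'a::euclidean_space \<Rightarrow> real"
  assumes "strongly_convex m F" "m > 0" "F differentiable_on UNIV"
  shows "F (arg_min F (\<lambda>_. True)) \<le> F u"
proof -
  have diff: "F differentiable (at x)" for x
    using assms(3) unfolding differentiable_on_def by simp
  define D where "D = gradient F 0"
  \<comment> \<open>Beyond this radius the quadratic term of the tangent bound at 0 outweighs the
    linear one.\<close>
  define r where "r = 2 * norm D / m"
  have "r \<ge> 0"
    using \<open>m > 0\<close> by (simp add: r_def)
  have "continuous_on (cball 0 r) F"
    using assms(3) differentiable_imp_continuous_on continuous_on_subset by blast
  then obtain v where v: "\<And>w. w \<in> cball 0 r \<Longrightarrow> F v \<le> F w"
    using continuous_attains_inf[of "cball 0 r" F] \<open>r \<ge> 0\<close>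
    by (metis compact_cball centre_in_cball empty_iff)
  have "F v \<le> F w" for w
  proof (cases "norm w \<le> r")
    case False
    then have "norm D * 2 \<le> m * norm w"
      using \<open>m > 0\<close> by (simp add: r_def field_simps)
    then have "norm D * norm w \<le> m / 2 * norm w * norm w"
      by (intro mult_right_mono) auto
    moreover have "- (w \<bullet> D) \<le> norm D * norm w"
      using norm_cauchy_schwarz[of "- w" D] by (simp add: mult.commute)
    moreover have "F 0 + w \<bullet> D + m / 2 * (norm w)\<^sup>2 \<le> F w"
      using strongly_convex_above_tangent[OF assms(1) GDERIV_gradient[OF diff], of 0 w]
      by (simp add: D_def)
    ultimately have "F 0 \<le> F w"
      by (simp add: power2_eq_square)
    with v[of 0] \<open>r \<ge> 0\<close> show ?thesis
      by simp
  qed (use v in auto)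
  then have "is_arg_min F (\<lambda>_. True) v"
    by (simp add: is_arg_min_linorder)
  then have "is_arg_min F (\<lambda>_. True) (arg_min F (\<lambda>_. True))"
    unfolding arg_min_def by (rule someI)
  then show ?thesis
    by (simp add: is_arg_min_linorder)
qed

text \<open>Test the direction \<open>- D\<close>: its one-sided derivative is
  \<open>- (D \<bullet> D)\<close>, and minimality makes it nonnegative.\<close>

lemma GDERIV_at_minimum:
  assumes "GDERIV F v :> D" "\<And>u. F v \<le> F u"
  shows "D = 0"
proof -
  have "0 \<le> (- D) \<bullet> D"
  proof (rule tendsto_lowerbound)
    show "((\<lambda>t. (F (v + t *\<^sub>R (- D)) - F v) /\<^sub>R t) \<longlongrightarrow> (- D) \<bullet> D) (at_right 0)"
      using directional_derivative_tendsto[OF assms(1)[unfolded gderiv_def]] .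
    show "\<forall>\<^sub>F t in at_right 0. 0 \<le> (F (v + t *\<^sub>R (- D)) - F v) /\<^sub>R t"
      by (rule eventually_at_rightI[of 0 1]) (use assms(2) in auto)
  qed simp
  then show ?thesis
    by (metis inner_minus_left inner_gt_zero_iff neg_0_le_iff_le not_less)
qed

text \<open>At step size \<open>1 / l\<close> the function gaps from the tangent bound and from the
  gradient bound cancel exactly; only the quadratic term of strong convexity survives.\<close>

lemma gradient_step_contraction:
  fixes F :: "'a::euclidean_space \<Rightarrow> real"
  assumes "smooth l F" "strongly_convex m F" "l > 0" "\<And>u. F v \<le> F u"
  shows "(norm (y - (1 / l) *\<^sub>R gradient F y - v))\<^sup>2 \<le> (1 - m / l) * (norm (y - v))\<^sup>2"
proof -
  let ?D = "gradient F y"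
  have "GDERIV F y :> ?D"
    using assms(1) by (simp add: smooth_def differentiable_on_def GDERIV_gradient)
  from strongly_convex_above_tangent[OF assms(2) this, of v]
  have 1: "F y - F v + m / 2 * (norm (y - v))\<^sup>2 \<le> (y - v) \<bullet> ?D"
    by (simp add: inner_diff_left norm_minus_commute[of y v])
  have 2: "(norm ?D)\<^sup>2 \<le> 2 * l * (F y - F v)"
    using smooth_gradient_norm_le[OF assms(1,3,4)] .
  have "(norm (y - (1 / l) *\<^sub>R ?D - v))\<^sup>2 = (norm (y - v - (1 / l) *\<^sub>R ?D))\<^sup>2"
    by (simp add: algebra_simps)
  also have "\<dots> = (norm (y - v))\<^sup>2 - 2 / l * ((y - v) \<bullet> ?D) + 1 / l\<^sup>2 * (norm ?D)\<^sup>2"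
    unfolding power2_norm_diff_scaleR by (simp add: power_divide)
  also have "\<dots> \<le> (norm (y - v))\<^sup>2 - 2 / l * (F y - F v + m / 2 * (norm (y - v))\<^sup>2)
      + 1 / l\<^sup>2 * (2 * l * (F y - F v))"
    using 1 2 \<open>l > 0\<close> by (intro add_mono diff_left_mono mult_left_mono) auto
  also have "\<dots> = (1 - m / l) * (norm (y - v))\<^sup>2"
    using \<open>l > 0\<close> by (simp add: field_simps power2_eq_square)
  finally show ?thesis .
qed

section \<open>Symmetry and spectral bounds of second derivatives\<close>

text \<open>The second difference over a parallelogram is symmetric in \<open>h\<close> and
  \<open>k\<close>. Approximating it by \<open>h \<bullet> H k\<close> uses the derivative of
  \<open>G\<close> at the single point \<open>y\<close>, so no continuity of second derivatives
  enters.\<close>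

lemma second_difference_estimate:
  fixes F :: "'a::euclidean_space \<Rightarrow> real"
  assumes "\<And>x. GDERIV F x :> G x" "(G has_derivative H) (at y)" "e > 0"
  shows "\<forall>\<^sub>F t in at_right 0.
    \<bar>(F (y + t *\<^sub>R h + t *\<^sub>R k) - F (y + t *\<^sub>R h) - F (y + t *\<^sub>R k) + F y) / t\<^sup>2 - h \<bullet> H k\<bar>
      \<le> e * (2 * (norm h + norm k)\<^sup>2)"
proof -
  let ?K = "norm h + norm k"
  have lin: "linear H"
    using assms(2) has_derivative_linear by blast
  obtain d where d: "d > 0" "\<And>w. norm w < d \<Longrightarrow> norm (G (y + w) - G y - H w) \<le> e * norm w"
  proof -
    obtain d where "d > 0" "\<And>z. norm (z - y) < d \<Longrightarrow> norm (G z - G y - H (z - y)) \<le> e * norm (z - y)"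
      using assms(2,3) unfolding has_derivative_at_alt by metis
    then show ?thesis
      using that[of d] by (metis add_diff_cancel_left')
  qed
  have K: "d / (?K + 1) > 0"
    using \<open>d > 0\<close> by (intro divide_pos_pos add_nonneg_pos) auto
  show ?thesis
  proof (rule eventually_at_rightI[OF _ K])
    fix t assume "t \<in> {0<..<d / (?K + 1)}"
    then have t: "0 < t" "t * (?K + 1) < d"
      by (auto simp: pos_less_divide_eq add_nonneg_pos)
    \<comment> \<open>The increment in direction \<open>k\<close>, followed along \<open>h\<close>:
      the mean value theorem turns the second difference into a difference of two values of
      \<open>G\<close> near \<open>y\<close>.\<close>
    define \<phi> where "\<phi> s = F (y + t *\<^sub>R k + s *\<^sub>R h) - F (y + s *\<^sub>R h)" for s
    have "(\<phi> has_real_derivative h \<bullet> (G (y + t *\<^sub>R k + s *\<^sub>R h) - G (y + s *\<^sub>R h))) (at s)" for s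
      unfolding \<phi>_def inner_diff_right
      by (intro derivative_intros GDERIV_along_line assms(1))
    from MVT2[OF \<open>0 < t\<close> this] obtain s where s: "0 < s" "s < t"
      "\<phi> t - \<phi> 0 = (t - 0) * (h \<bullet> (G (y + t *\<^sub>R k + s *\<^sub>R h) - G (y + s *\<^sub>R h)))"
      by blast
    define R where "R w = G (y + w) - G y - H w" for w
    have small: "norm (R w) \<le> e * (t * ?K)" if "norm w \<le> t * ?K" for w
    proof -
      have "norm w < d"
        using that t by (simp add: distrib_left)
      then show ?thesis
        unfolding R_def using d(2)[of w] that \<open>e > 0\<close>
        by (meson order_trans mult_left_mono less_imp_le)
    qed
    have "norm (s *\<^sub>R h) \<le> t * norm h"
      using s by (simp add: mult_right_mono)
    moreover have "norm (t *\<^sub>R k + s *\<^sub>R h) \<le> t * norm k + s * norm h"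
      using s t by (intro norm_triangle_le) auto
    ultimately have w: "norm (s *\<^sub>R h) \<le> t * ?K" "norm (t *\<^sub>R k + s *\<^sub>R h) \<le> t * ?K"
      using s t mult_right_mono[of s t "norm h"]
      by (auto simp: distrib_left intro: order_trans add_increasing2)
    let ?\<Delta> = "F (y + t *\<^sub>R h + t *\<^sub>R k) - F (y + t *\<^sub>R h) - F (y + t *\<^sub>R k) + F y"
    have "?\<Delta> = \<phi> t - \<phi> 0"
      by (simp add: \<phi>_def algebra_simps)
    also have "\<dots> = t * (h \<bullet> (H (t *\<^sub>R k) + (R (t *\<^sub>R k + s *\<^sub>R h) - R (s *\<^sub>R h))))"
      using s(3) by (simp add: R_def linear_add[OF lin] algebra_simps)
    also have "\<dots> = t\<^sup>2 * (h \<bullet> H k) + t * (h \<bullet> (R (t *\<^sub>R k + s *\<^sub>R h) - R (s *\<^sub>R h)))"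
      by (simp add: linear_cmul[OF lin] inner_add_right power2_eq_square algebra_simps)
    finally have "?\<Delta> / t\<^sup>2 - h \<bullet> H k = h \<bullet> (R (t *\<^sub>R k + s *\<^sub>R h) - R (s *\<^sub>R h)) / t"
      using t by (simp add: field_simps power2_eq_square)
    then have "\<bar>?\<Delta> / t\<^sup>2 - h \<bullet> H k\<bar> = \<bar>h \<bullet> (R (t *\<^sub>R k + s *\<^sub>R h) - R (s *\<^sub>R h))\<bar> / t"
      using t by simp
    also have "\<dots> \<le> norm h * (e * (t * ?K) + e * (t * ?K)) / t"
    proof (intro divide_right_mono order_trans[OF Cauchy_Schwarz_ineq2] mult_left_mono)
      show "norm (R (t *\<^sub>R k + s *\<^sub>R h) - R (s *\<^sub>R h)) \<le> e * (t * ?K) + e * (t * ?K)"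
        using norm_triangle_ineq4[of "R (t *\<^sub>R k + s *\<^sub>R h)" "R (s *\<^sub>R h)"]
          small[OF w(1)] small[OF w(2)] by linarith
    qed (use t in auto)
    also have "\<dots> = e * (2 * (norm h * ?K))"
      using t by (simp add: field_simps)
    also have "\<dots> \<le> e * (2 * ?K\<^sup>2)"
      unfolding power2_eq_square using \<open>e > 0\<close> by (intro mult_left_mono mult_right_mono) auto
    finally show "\<bar>?\<Delta> / t\<^sup>2 - h \<bullet> H k\<bar> \<le> e * (2 * ?K\<^sup>2)" .
  qed
qed

lemma second_derivative_symmetric:
  fixes F :: "'a::euclidean_space \<Rightarrow> real"
  assumes "\<And>x. GDERIV F x :> G x" "(G has_derivative H) (at y)"
  shows "h \<bullet> H k = k \<bullet> H h"
proof -
  let ?K = "4 * (norm h + norm k)\<^sup>2"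
  have *: "\<bar>h \<bullet> H k - k \<bullet> H h\<bar> \<le> e * ?K" if "e > 0" for e
  proof -
    have "\<forall>\<^sub>F t::real in at_right 0. \<bar>h \<bullet> H k - k \<bullet> H h\<bar> \<le> e * ?K"
      using second_difference_estimate[OF assms that, of h k]
        second_difference_estimate[OF assms that, of k h]
      by eventually_elim (simp add: algebra_simps)
    then show ?thesis
      by (simp add: eventually_const)
  qed
  have "\<bar>h \<bullet> H k - k \<bullet> H h\<bar> \<le> 0 + e" if "e > 0" for e
  proof -
    \<comment> \<open>The denominator \<open>?K + 1\<close> stays positive when \<open>h\<close> and
      \<open>k\<close> both vanish.\<close>
    have "\<bar>h \<bullet> H k - k \<bullet> H h\<bar> \<le> e / (?K + 1) * ?K"
      using that by (intro *) (simp add: add_nonneg_pos)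
    also have "\<dots> \<le> e"
      using that by (simp add: divide_le_eq add_nonneg_pos mult_left_mono)
    finally show ?thesis by simp
  qed
  then have "\<bar>h \<bullet> H k - k \<bullet> H h\<bar> \<le> 0"
    by (rule field_le_epsilon)
  then show ?thesis
    by simp
qed

lemma lipschitz_derivative_norm_le:
  assumes "(G has_derivative H) (at y)" "\<And>u v. norm (G u - G v) \<le> l * norm (u - v)"
  shows "norm (H h) \<le> l * norm h"
proof (rule tendsto_upperbound)
  show "((\<lambda>t. norm ((G (y + t *\<^sub>R h) - G y) /\<^sub>R t)) \<longlongrightarrow> norm (H h)) (at_right 0)"
    by (intro tendsto_norm directional_derivative_tendsto assms(1))
  show "\<forall>\<^sub>F t in at_right 0. norm ((G (y + t *\<^sub>R h) - G y) /\<^sub>R t) \<le> l * norm h"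
  proof (rule eventually_at_rightI[of 0 1])
    fix t :: real assume "t \<in> {0<..<1}"
    then show "norm ((G (y + t *\<^sub>R h) - G y) /\<^sub>R t) \<le> l * norm h"
      using assms(2)[of "y + t *\<^sub>R h" y]
      by (simp add: pos_divide_le_eq flip: divide_inverse_commute) (simp add: mult_ac)
  qed simp
qed simp

lemma monotone_derivative_ge:
  assumes "(G has_derivative H) (at y)" "\<And>u v. m * (norm (u - v))\<^sup>2 \<le> (u - v) \<bullet> (G u - G v)"
  shows "m * (norm h)\<^sup>2 \<le> h \<bullet> H h"
proof (rule tendsto_lowerbound)
  show "((\<lambda>t. h \<bullet> ((G (y + t *\<^sub>R h) - G y) /\<^sub>R t)) \<longlongrightarrow> h \<bullet> H h) (at_right 0)"
    by (intro tendsto_intros directional_derivative_tendsto assms(1))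
  show "\<forall>\<^sub>F t in at_right 0. m * (norm h)\<^sup>2 \<le> h \<bullet> ((G (y + t *\<^sub>R h) - G y) /\<^sub>R t)"
  proof (rule eventually_at_rightI[of 0 1])
    fix t :: real assume "t \<in> {0<..<1}"
    then show "m * (norm h)\<^sup>2 \<le> h \<bullet> ((G (y + t *\<^sub>R h) - G y) /\<^sub>R t)"
      using assms(2)[of "y + t *\<^sub>R h" y]
      by (simp add: power2_eq_square pos_le_divide_eq flip: divide_inverse_commute) (simp add: mult_ac)
  qed simp
qed simp

text \<open>The square of \<open>norm (H e)\<close> is controlled by cocoercivity, which follows
  from nonnegativity of the quadratic form at \<open>e - (1 / l) *\<^sub>R H e\<close>.\<close>

lemma symmetric_step_contraction:
  fixes H :: "'a::real_inner \<Rightarrow> 'a"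
  assumes "linear H" "\<And>h k. h \<bullet> H k = k \<bullet> H h" "\<And>h. m * (norm h)\<^sup>2 \<le> h \<bullet> H h"
    "\<And>h. norm (H h) \<le> l * norm h" "l > 0" "m > 0"
  shows "(norm (e - (1 / (2 * l)) *\<^sub>R H e))\<^sup>2 \<le> (1 - m / (2 * l)) * (norm e)\<^sup>2"
proof -
  let ?u = "H e"
  have "?u \<bullet> H ?u \<le> norm ?u * (l * norm ?u)"
    by (intro order_trans[OF norm_cauchy_schwarz] mult_left_mono assms(4)) auto
  moreover have "0 \<le> (e - (1 / l) *\<^sub>R ?u) \<bullet> H (e - (1 / l) *\<^sub>R ?u)"
    using assms(3)[of "e - (1 / l) *\<^sub>R ?u"] \<open>m > 0\<close>
    by (meson order_trans zero_le_power2 mult_nonneg_nonneg less_imp_le)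
  moreover have "(e - (1 / l) *\<^sub>R ?u) \<bullet> H (e - (1 / l) *\<^sub>R ?u)
      = e \<bullet> ?u - 2 / l * (norm ?u)\<^sup>2 + 1 / l\<^sup>2 * (?u \<bullet> H ?u)"
    using assms(2)[of e ?u] unfolding linear_diff[OF assms(1)] linear_cmul[OF assms(1)]
    by (simp add: inner_diff_left inner_diff_right power2_norm_eq_inner power2_eq_square[of l]
        diff_divide_distrib)
  ultimately have "0 \<le> e \<bullet> ?u - 2 / l * (norm ?u)\<^sup>2 + 1 / l\<^sup>2 * (norm ?u * (l * norm ?u))"
    using mult_left_mono[of "?u \<bullet> H ?u" "norm ?u * (l * norm ?u)" "1 / l\<^sup>2"] by simp
  then have coc: "(norm ?u)\<^sup>2 \<le> l * (e \<bullet> ?u)"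
    using \<open>l > 0\<close> by (simp add: field_simps power2_eq_square)
  have "(norm (e - (1 / (2 * l)) *\<^sub>R ?u))\<^sup>2
      = (norm e)\<^sup>2 - 1 / l * (e \<bullet> ?u) + 1 / (4 * l\<^sup>2) * (norm ?u)\<^sup>2"
    unfolding power2_norm_diff_scaleR by (simp add: power_divide)
  also have "\<dots> \<le> (norm e)\<^sup>2 - 1 / l * (e \<bullet> ?u) + 1 / (4 * l\<^sup>2) * (l * (e \<bullet> ?u))"
    using coc by (intro add_left_mono mult_left_mono) auto
  also have "\<dots> = (norm e)\<^sup>2 - 3 / (4 * l) * (e \<bullet> ?u)"
    using \<open>l > 0\<close> by (simp add: field_simps power2_eq_square)
  also have "\<dots> \<le> (norm e)\<^sup>2 - 3 / (4 * l) * (m * (norm e)\<^sup>2)"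
    using assms(3)[of e] \<open>l > 0\<close> by (intro diff_left_mono mult_left_mono) auto
  \<comment> \<open>The factor reached so far is \<open>1 - 3 * m / (4 * l)\<close>; it is relaxed
    to the one used for the loop.\<close>
  also have "\<dots> \<le> (1 - m / (2 * l)) * (norm e)\<^sup>2"
  proof -
    have "0 \<le> m / (l * 4) * (norm e)\<^sup>2"
      using \<open>l > 0\<close> \<open>m > 0\<close> by simp
    then show ?thesis
      by (simp add: field_simps)
  qed
  finally show ?thesis .
qed

section \<open>Sensitivity of the inner problem and the hypergradient\<close>

lemma has_derivative_partial:
  assumes "(G has_derivative D) (at (x, y))"
  shows has_derivative_partial_fst: "((\<lambda>u. G (u, y)) has_derivative (\<lambda>h. D (h, 0))) (at x)"
    and has_derivative_partial_snd: "((\<lambda>v. G (x, v)) has_derivative (\<lambda>k. D (0, k))) (at y)"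
proof -
  show "((\<lambda>u. G (u, y)) has_derivative (\<lambda>h. D (h, 0))) (at x)"
    by (rule has_derivative_compose[where f = "\<lambda>u. (u, y)"])
      (use assms in \<open>auto intro!: derivative_eq_intros\<close>)
  show "((\<lambda>v. G (x, v)) has_derivative (\<lambda>k. D (0, k))) (at y)"
    by (rule has_derivative_compose[where f = "\<lambda>v. (x, v)"])
      (use assms in \<open>auto intro!: derivative_eq_intros\<close>)
qed

lemma GDERIV_partial:
  assumes "GDERIV F (x, y) :> D"
  shows GDERIV_partial_fst: "GDERIV (\<lambda>u. F (u, y)) x :> fst D"
    and GDERIV_partial_snd: "GDERIV (\<lambda>v. F (x, v)) y :> snd D"
  using has_derivative_partial[OF assms[unfolded gderiv_def]]
  by (simp_all add: gderiv_def inner_prod_def)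

text \<open>A square matrix with trivial kernel has a two-sided inverse, which is what the choice
  inside \<open>matrix_inv\<close> requires.\<close>

lemma matrix_inv_right_mult:
  fixes A :: "real^'n^'n"
  assumes "\<And>v. A *v v = 0 \<Longrightarrow> v = 0"
  shows "A *v (matrix_inv A *v v) = v"
proof -
  have "\<exists>A'. A ** A' = mat 1 \<and> A' ** A = mat 1"
    using assms matrix_left_invertible_ker[of A] matrix_left_right_inverse by blast
  then have "A ** matrix_inv A = mat 1 \<and> matrix_inv A ** A = mat 1"
    unfolding matrix_inv_def by (rule someI_ex)
  then show ?thesis
    by (simp add: matrix_vector_mul_assoc)
qed

lemma op_lipschitzD:
  assumes "op_lipschitz M A"
  shows "norm (A x y *v v - A x' y' *v v) \<le> M * norm ((x, y) - (x', y')) * norm v"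
proof -
  have "norm ((A x y - A x' y') *v v) \<le> onorm (\<lambda>v. (A x y - A x' y') *v v) * norm v"
    by (rule onorm) (rule matrix_vector_mul_bounded_linear)
  also have "\<dots> \<le> M * dist (x, y) (x', y') * norm v"
    using assms unfolding op_lipschitz_def by (intro mult_right_mono) auto
  finally show ?thesis
    by (simp add: matrix_vector_mult_diff_rdistrib dist_norm)
qed

locale bilevel =
  fixes f g :: "(real^'m) \<times> (real^'n) \<Rightarrow> real" and Lf B Lg Lg' Mg mug :: real
  assumes constants: "0 \<le> Lf" "0 \<le> B" "0 < Lg" "0 < Lg'" "0 \<le> Mg"
    and f_differentiable: "f differentiable_on UNIV"
    and g_twice_differentiable: "twice_differentiable g"
    and A1: "assm_A1 g Lg mug" and A2: "assm_A2 f Lf B" and A3: "assm_A3 g Mg Lg'"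
begin

section \<open>Derivatives and curvature of the inner objective\<close>

lemma mug_pos: "0 < mug"
  using A1 by (simp add: assm_A1_def)

lemma GDERIV_f: "GDERIV f p :> gradient f p"
  using f_differentiable unfolding differentiable_on_def by (intro GDERIV_gradient) blast

lemma GDERIV_g: "GDERIV g p :> gradient g p"
  using g_twice_differentiable unfolding twice_differentiable_def differentiable_on_def
  by (intro GDERIV_gradient) blast

lemma grad_x_f: "grad_x f x y = fst (gradient f (x, y))"
  unfolding grad_x_def by (rule gradient_eqI[OF GDERIV_partial_fst[OF GDERIV_f]])

lemma grad_y_f: "grad_y f x y = snd (gradient f (x, y))"
  unfolding grad_y_def by (rule gradient_eqI[OF GDERIV_partial_snd[OF GDERIV_f]])

lemma grad_y_g: "grad_y g x y = snd (gradient g (x, y))"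
  unfolding grad_y_def by (rule gradient_eqI[OF GDERIV_partial_snd[OF GDERIV_g]])

lemma GDERIV_g_y: "GDERIV (\<lambda>v. g (x, v)) y :> grad_y g x y"
  unfolding grad_y_g by (rule GDERIV_partial_snd[OF GDERIV_g])

lemma smooth_g: "smooth Lg (\<lambda>y. g (x, y))"
  using A1 by (simp add: assm_A1_def)

lemma strongly_convex_g: "strongly_convex mug (\<lambda>y. g (x, y))"
  using A1 by (simp add: assm_A1_def)

text \<open>The two matrices are Jacobians of partial maps. Joint differentiability of the gradient
  makes them blocks of one derivative, as needed when \<open>x\<close> and \<open>y\<close> move
  together along the graph of \<open>y_star g\<close>.\<close>

lemma grad_y_g_has_derivative:
  "((\<lambda>p. grad_y g (fst p) (snd p)) has_derivative
    (\<lambda>p. fst p v* hess_xy g x y + hess_yy g x y *v snd p)) (at (x, y))"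
proof -
  obtain D where D: "(gradient g has_derivative D) (at (x, y))"
    using g_twice_differentiable unfolding twice_differentiable_def differentiable_on_def
    by (metis UNIV_I differentiable_def)
  then have joint: "((\<lambda>p. grad_y g (fst p) (snd p)) has_derivative (\<lambda>p. snd (D p))) (at (x, y))"
    by (simp add: grad_y_g has_derivative_snd)
  have dx: "((\<lambda>u. grad_y g u y) has_derivative (\<lambda>h. snd (D (h, 0)))) (at x)"
    using has_derivative_partial_fst[OF joint] by simp
  have dy: "((\<lambda>v. grad_y g x v) has_derivative (\<lambda>k. snd (D (0, k)))) (at y)"
    using has_derivative_partial_snd[OF joint] by simp
  have "((\<lambda>u. grad_y g u y) has_derivative (\<lambda>h. h v* hess_xy g x y)) (at x)"
    using dx jacobian_works[of "\<lambda>u. grad_y g u y" "at x"]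
    by (auto simp: hess_xy_def differentiable_def)
  then have "(\<lambda>h. h v* hess_xy g x y) = (\<lambda>h. snd (D (h, 0)))"
    using dx has_derivative_unique by blast
  then have hx: "snd (D (h, 0)) = h v* hess_xy g x y" for h
    by metis
  have "(grad_y g x has_derivative (\<lambda>k. hess_yy g x y *v k)) (at y)"
    using dy jacobian_works[of "grad_y g x" "at y"]
    by (auto simp: hess_yy_def differentiable_def)
  then have "(\<lambda>k. hess_yy g x y *v k) = (\<lambda>k. snd (D (0, k)))"
    using dy has_derivative_unique by blast
  then have hy: "snd (D (0, k)) = hess_yy g x y *v k" for k
    by metis
  have "D p = D (fst p, 0) + D (0, snd p)" for p
    using linear_add[OF has_derivative_linear[OF D], of "(fst p, 0)" "(0, snd p)"] by simp
  then have "snd (D p) = fst p v* hess_xy g x y + hess_yy g x y *v snd p" for p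
    using hx hy by (metis snd_add)
  then show ?thesis
    using joint by simp
qed

lemma grad_y_g_has_derivative_x:
  "((\<lambda>u. grad_y g u y) has_derivative (\<lambda>h. h v* hess_xy g x y)) (at x)"
  using has_derivative_partial_fst[OF grad_y_g_has_derivative] by simp

lemma grad_y_g_has_derivative_y:
  "(grad_y g x has_derivative (\<lambda>k. hess_yy g x y *v k)) (at y)"
  using has_derivative_partial_snd[OF grad_y_g_has_derivative] by simp

lemma grad_y_g_lipschitz_x: "norm (grad_y g x y - grad_y g x' y) \<le> Lg' * norm (x - x')"
  using A3 by (simp add: assm_A3_def)

lemma grad_y_g_lipschitz_y: "norm (grad_y g x y - grad_y g x y') \<le> Lg * norm (y - y')"
  using smooth_g[of x] lipschitz_onD[of Lg UNIV "gradient (\<lambda>y. g (x, y))" y y']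
  unfolding smooth_def grad_y_def dist_norm by blast

lemma grad_y_g_monotone: "mug * (norm (y - y'))\<^sup>2 \<le> (y - y') \<bullet> (grad_y g x y - grad_y g x y')"
  by (rule strongly_convex_gradient_monotone[OF strongly_convex_g GDERIV_g_y GDERIV_g_y])

lemma hess_yy_symmetric: "h \<bullet> (hess_yy g x y *v k) = k \<bullet> (hess_yy g x y *v h)"
  by (rule second_derivative_symmetric[OF GDERIV_g_y grad_y_g_has_derivative_y])

lemma hess_yy_ge: "mug * (norm h)\<^sup>2 \<le> h \<bullet> (hess_yy g x y *v h)"
  by (rule monotone_derivative_ge[OF grad_y_g_has_derivative_y grad_y_g_monotone])

lemma hess_yy_norm_le: "norm (hess_yy g x y *v h) \<le> Lg * norm h"
  by (rule lipschitz_derivative_norm_le[OF grad_y_g_has_derivative_y grad_y_g_lipschitz_y])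

text \<open>Cauchy-Schwarz in the curvature bound. It turns any linear system with this Hessian into
  an estimate of its solution, and it shows invertibility.\<close>

lemma hess_yy_norm_ge: "mug * norm h \<le> norm (hess_yy g x y *v h)"
proof (cases "h = 0")
  case False
  have "mug * norm h * norm h \<le> norm (hess_yy g x y *v h) * norm h"
    using order_trans[OF hess_yy_ge norm_cauchy_schwarz, of h x y]
    by (simp add: power2_eq_square mult_ac)
  with False show ?thesis
    by simp
qed simp

text \<open>The Lipschitz condition bounds the transposed product \<open>h v* hess_xy g x y\<close>;
  choosing \<open>h\<close> as the image \<open>?u\<close> carries the bound over to the matrix
  itself.\<close>

lemma hess_xy_norm_le: "norm (hess_xy g x y *v z) \<le> Lg' * norm z"
proof (cases "hess_xy g x y *v z = 0")
  case False
  let ?u = "hess_xy g x y *v z"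
  have "norm ?u * norm ?u = (?u v* hess_xy g x y) \<bullet> z"
    by (simp add: dot_lmul_matrix power2_norm_eq_inner flip: power2_eq_square)
  also have "\<dots> \<le> (Lg' * norm ?u) * norm z"
    by (intro order_trans[OF norm_cauchy_schwarz] mult_right_mono
        lipschitz_derivative_norm_le[OF grad_y_g_has_derivative_x grad_y_g_lipschitz_x]) auto
  finally have "norm ?u * norm ?u \<le> (Lg' * norm z) * norm ?u"
    by (simp add: mult_ac)
  with False show ?thesis
    by simp
qed (use constants in simp)

lemma hess_yy_matrix_inv: "hess_yy g x y *v (matrix_inv (hess_yy g x y) *v v) = v"
proof (rule matrix_inv_right_mult)
  fix v assume "hess_yy g x y *v v = 0"
  then show "v = 0"
    using hess_yy_norm_ge[of v x y] mug_pos by (simp add: mult_le_0_iff)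
qed

lemma hess_yy_z_star: "hess_yy g x y *v z_star f g x y = - grad_y f x y"
  using hess_yy_matrix_inv[of x y "grad_y f x y"]
  by (simp add: z_star_def linear_neg[OF matrix_vector_mul_linear])

section \<open>Sensitivity of the inner minimizer\<close>

lemma y_star_le: "g (x, y_star g x) \<le> g (x, u)"
  unfolding y_star_def
  using strongly_convex_arg_min[OF strongly_convex_g mug_pos, of x u] smooth_g[of x]
  by (simp add: smooth_def)

lemma grad_y_g_y_star: "grad_y g x (y_star g x) = 0"
  by (rule GDERIV_at_minimum[OF GDERIV_g_y y_star_le])

text \<open>Apply monotonicity at the two minimizers: both gradients vanish at their own
  \<open>x\<close>, so only the change of \<open>grad_y g\<close> in \<open>x\<close> is
  left.\<close>

lemma y_star_lipschitz: "norm (y_star g x - y_star g x') \<le> Lg' / mug * norm (x - x')"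
proof (cases "y_star g x = y_star g x'")
  case False
  let ?d = "y_star g x - y_star g x'"
  have "mug * (norm ?d)\<^sup>2 \<le> ?d \<bullet> (grad_y g x (y_star g x) - grad_y g x (y_star g x'))"
    by (rule grad_y_g_monotone)
  also have "\<dots> = ?d \<bullet> (grad_y g x' (y_star g x') - grad_y g x (y_star g x'))"
    by (simp add: grad_y_g_y_star)
  also have "\<dots> \<le> norm ?d * (Lg' * norm (x - x'))"
    using grad_y_g_lipschitz_x[of x' "y_star g x'" x]
    by (intro order_trans[OF norm_cauchy_schwarz] mult_left_mono) (auto simp: norm_minus_commute)
  finally have "norm ?d * (mug * norm ?d) \<le> norm ?d * (Lg' * norm (x - x'))"
    by (simp add: power2_eq_square mult_ac)
  with False have "mug * norm ?d \<le> Lg' * norm (x - x')"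
    by simp
  then show ?thesis
    using mug_pos by (simp add: field_simps)
qed (use constants mug_pos in simp)

lemma graph_y_star_lipschitz:
  "norm ((x, y_star g x) - (x', y_star g x')) \<le> (1 + Lg' / mug) * norm (x - x')"
  using norm_Pair_le[of "x - x'" "y_star g x - y_star g x'"] y_star_lipschitz[of x x']
  by (simp add: distrib_right)

text \<open>The remainder estimate for \<open>grad_y g\<close> along the graph of \<open>y_star g\<close>, where
  \<open>grad_y g\<close> vanishes, turns the Lipschitz continuity of \<open>y_star g\<close> into differentiability.\<close>

lemma y_star_has_derivative:
  "(y_star g has_derivative
    (\<lambda>h. - (matrix_inv (hess_yy g x (y_star g x)) *v (h v* hess_xy g x (y_star g x))))) (at x)"
  unfolding has_derivative_at_alt
proof (intro conjI allI impI)
  let ?y = "y_star g x"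
  let ?H = "hess_yy g x ?y" and ?A = "hess_xy g x ?y"
  have "bounded_linear (\<lambda>h. matrix_inv ?H *v (transpose ?A *v h))"
    by (intro bounded_linear_compose[OF matrix_vector_mul_bounded_linear matrix_vector_mul_bounded_linear])
  then show "bounded_linear (\<lambda>h. - (matrix_inv ?H *v (h v* ?A)))"
    by (simp add: bounded_linear_minus)
  fix e :: real assume "e > 0"
  define K where "K = 1 + Lg' / mug"
  have "K > 0"
    using constants mug_pos by (simp add: K_def add_pos_pos)
  \<comment> \<open>The tolerance is scaled so that the Lipschitz factor \<open>K\<close> of the
    graph and the factor \<open>1 / mug\<close> of the inverse Hessian cancel.\<close>
  then have "e * mug / K > 0"
    using \<open>e > 0\<close> mug_pos by simp
  then obtain d where d: "d > 0" "\<And>p. norm (p - (x, ?y)) < d \<Longrightarrow>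
      norm (grad_y g (fst p) (snd p) - grad_y g x ?y - (fst (p - (x, ?y)) v* ?A + ?H *v snd (p - (x, ?y))))
        \<le> e * mug / K * norm (p - (x, ?y))"
    using grad_y_g_has_derivative[of x ?y] unfolding has_derivative_at_alt by fastforce
  show "\<exists>d>0. \<forall>u. norm (u - x) < d \<longrightarrow>
      norm (y_star g u - ?y - - (matrix_inv ?H *v ((u - x) v* ?A))) \<le> e * norm (u - x)"
  proof (intro exI[of _ "d / K"] conjI allI impI)
    fix u assume "norm (u - x) < d / K"
    let ?w = "y_star g u - ?y - - (matrix_inv ?H *v ((u - x) v* ?A))"
    have graph: "norm ((u, y_star g u) - (x, ?y)) \<le> K * norm (u - x)"
      using graph_y_star_lipschitz[of u x] by (simp only: K_def)
    also have "\<dots> < d"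
      using \<open>norm (u - x) < d / K\<close> \<open>K > 0\<close> by (simp add: field_simps)
    finally have small: "norm ((u, y_star g u) - (x, ?y)) < d" .
    \<comment> \<open>Multiplying by the Hessian removes the inverse; what is left is minus the
      remainder of \<open>grad_y g\<close>, whose values at both graph points are zero.\<close>
    have "?H *v ?w = (u - x) v* ?A + ?H *v (y_star g u - ?y)"
      by (simp add: matrix_vector_right_distrib hess_yy_matrix_inv)
    then have "mug * norm ?w \<le> norm ((u - x) v* ?A + ?H *v (y_star g u - ?y))"
      using hess_yy_norm_ge[of ?w x ?y] by simp
    also have "\<dots> = norm (grad_y g u (y_star g u) - grad_y g x ?y - ((u - x) v* ?A + ?H *v (y_star g u - ?y)))"
      unfolding grad_y_g_y_star by (metis diff_0 diff_self norm_minus_cancel)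
    also have "\<dots> \<le> e * mug / K * norm ((u, y_star g u) - (x, ?y))"
      using d(2)[OF small] by simp
    also have "\<dots> \<le> e * mug / K * (K * norm (u - x))"
      using \<open>e > 0\<close> \<open>K > 0\<close> mug_pos graph by (intro mult_left_mono) auto
    also have "\<dots> = mug * (e * norm (u - x))"
      using \<open>K > 0\<close> by simp
    finally show "norm ?w \<le> e * norm (u - x)"
      using mug_pos by simp
  qed (use \<open>d > 0\<close> \<open>K > 0\<close> in simp)
qed

section \<open>The hypergradient and its Lipschitz constants\<close>

text \<open>The gradient formula extended to \<open>y\<close> off the graph of
  \<open>y_star g\<close>, so that the errors in \<open>y\<close> and in \<open>z\<close> can be
  separated.\<close>

definition hyper :: "real^'m \<Rightarrow> real^'n \<Rightarrow> real^'m" where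
  "hyper x y = grad_x f x y + hess_xy g x y *v z_star f g x y"

text \<open>After the chain rule, symmetry of the Hessian moves its inverse from
  \<open>h v* ?A\<close> to the gradient of \<open>f\<close>, which produces
  \<open>z_star\<close>.\<close>

lemma GDERIV_outer_obj: "GDERIV (outer_obj f g) x :> hyper x (y_star g x)"
proof -
  let ?y = "y_star g x"
  let ?H = "hess_yy g x ?y" and ?A = "hess_xy g x ?y" and ?z = "z_star f g x ?y"
  let ?D = "\<lambda>h. - (matrix_inv ?H *v (h v* ?A))"
  have "((\<lambda>u. f (u, y_star g u)) has_derivative (\<lambda>h. (h, ?D h) \<bullet> gradient f (x, ?y))) (at x)"
    by (rule has_derivative_compose[where f = "\<lambda>u. (u, y_star g u)"])
      (use GDERIV_f in \<open>auto simp: gderiv_def intro!: has_derivative_Pair y_star_has_derivative\<close>)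
  moreover have "(h, ?D h) \<bullet> gradient f (x, ?y) = h \<bullet> hyper x ?y" for h
  proof -
    have "?D h \<bullet> grad_y f x ?y = (matrix_inv ?H *v (h v* ?A)) \<bullet> (?H *v ?z)"
      by (simp add: hess_yy_z_star)
    also have "\<dots> = (h v* ?A) \<bullet> ?z"
      by (subst hess_yy_symmetric) (simp add: hess_yy_matrix_inv inner_commute)
    finally show ?thesis
      by (simp add: inner_prod_def hyper_def grad_x_f grad_y_f inner_add_right dot_lmul_matrix)
  qed
  ultimately show ?thesis
    by (simp add: gderiv_def outer_obj_def[abs_def])
qed

lemma gradient_f_lipschitz: "norm (gradient f p - gradient f q) \<le> Lf * norm (p - q)"
  using A2 lipschitz_onD[of Lf UNIV "gradient f" p q] unfolding assm_A2_def dist_norm by blast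

lemma grad_x_f_lipschitz:
  "norm (grad_x f x y - grad_x f x' y') \<le> Lf * norm ((x, y) - (x', y'))"
  unfolding grad_x_f fst_diff[symmetric]
  by (metis gradient_f_lipschitz norm_fst_le order_trans prod.collapse)

lemma grad_y_f_lipschitz:
  "norm (grad_y f x y - grad_y f x' y') \<le> Lf * norm ((x, y) - (x', y'))"
  unfolding grad_y_f snd_diff[symmetric]
  by (metis gradient_f_lipschitz norm_snd_le order_trans prod.collapse)

lemma z_star_norm_le: "norm (z_star f g x y) \<le> B / mug"
proof -
  have "mug * norm (z_star f g x y) \<le> norm (grad_y f x y)"
    using hess_yy_norm_ge[of "z_star f g x y" x y] by (simp add: hess_yy_z_star)
  also have "\<dots> \<le> B"
    using A2 by (simp add: assm_A2_def)
  finally show ?thesis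
    using mug_pos by (simp add: field_simps)
qed

abbreviation "Ly \<equiv> const_Ly Lg' mug"
abbreviation "Lz \<equiv> const_Lz Lf B Mg mug"
abbreviation "Lpsi \<equiv> const_Lpsi Lf B Lg' Mg mug"
abbreviation "L \<equiv> const_L Lf B Lg' Mg mug"

text \<open>Subtract the two linear systems instead of the two inverses; the difference of the
  Hessians then acts only on \<open>?z'\<close>, whose norm is at most
  \<open>B / mug\<close>.\<close>

lemma z_star_lipschitz:
  "norm (z_star f g x y - z_star f g x' y') \<le> Lz * norm ((x, y) - (x', y'))"
proof -
  let ?H = "hess_yy g x y" and ?H' = "hess_yy g x' y'"
  let ?z = "z_star f g x y" and ?z' = "z_star f g x' y'"
  let ?d = "norm ((x, y) - (x', y'))"
  have "?H *v (?z - ?z') = (grad_y f x' y' - grad_y f x y) + (?H' *v ?z' - ?H *v ?z')"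
    by (simp add: matrix_vector_mult_diff_distrib hess_yy_z_star)
  then have "mug * norm (?z - ?z') \<le> norm (grad_y f x' y' - grad_y f x y) + norm (?H' *v ?z' - ?H *v ?z')"
    using hess_yy_norm_ge[of "?z - ?z'" x y]
      norm_triangle_ineq[of "grad_y f x' y' - grad_y f x y" "?H' *v ?z' - ?H *v ?z'"] by simp
  also have "norm (grad_y f x' y' - grad_y f x y) \<le> Lf * ?d"
    using grad_y_f_lipschitz[of x y x' y'] by (simp add: norm_minus_commute)
  also have "norm (?H' *v ?z' - ?H *v ?z') \<le> Mg * ?d * norm ?z'"
    using A3 op_lipschitzD[of Mg "hess_yy g" x y ?z' x' y']
    unfolding assm_A3_def by (simp add: norm_minus_commute)
  also have "Mg * ?d * norm ?z' \<le> Mg * ?d * (B / mug)"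
    using z_star_norm_le constants by (intro mult_left_mono) auto
  also have "Lf * ?d + Mg * ?d * (B / mug) = mug * (Lz * ?d)"
    using mug_pos by (simp add: const_Lz_def field_simps power2_eq_square)
  finally show ?thesis
    using mug_pos by simp
qed

lemma hyper_lipschitz:
  "norm (hyper x y - hyper x' y') \<le> (Lf + Mg * B / mug + Lg' * Lz) * norm ((x, y) - (x', y'))"
proof -
  let ?z = "z_star f g x y" and ?z' = "z_star f g x' y'"
  let ?d = "norm ((x, y) - (x', y'))"
  let ?a = "grad_x f x y - grad_x f x' y'" and ?b = "hess_xy g x y *v (?z - ?z')"
    and ?c = "hess_xy g x y *v ?z' - hess_xy g x' y' *v ?z'"
  have "norm ?a \<le> Lf * ?d"
    by (rule grad_x_f_lipschitz)
  moreover have "norm ?b \<le> Lg' * (Lz * ?d)"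
    using constants by (intro order_trans[OF hess_xy_norm_le] mult_left_mono z_star_lipschitz) auto
  moreover have "norm ?c \<le> Mg * ?d * norm ?z'"
    using A3 op_lipschitzD unfolding assm_A3_def by blast
  then have "norm ?c \<le> Mg * ?d * (B / mug)"
    using mult_left_mono[OF z_star_norm_le[of x' y'], of "Mg * ?d"] constants by simp
  moreover have "hyper x y - hyper x' y' = ?a + ?b + ?c"
    by (simp add: hyper_def matrix_vector_mult_diff_distrib)
  then have "norm (hyper x y - hyper x' y') \<le> norm ?a + norm ?b + norm ?c"
    using norm_triangle_ineq[of "?a + ?b" ?c] norm_triangle_ineq[of ?a ?b] by simp
  ultimately show ?thesis
    by (simp add: algebra_simps)
qed

text \<open>Explains the prescribed \<open>L\<close>: the Lipschitz constant of \<open>hyper\<close>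
  times that of the graph map \<open>x \<mapsto> (x, y_star g x)\<close>.\<close>

lemma const_L_factor: "L = (Lf + Mg * B / mug + Lg' * Lz) * (1 + Lg' / mug)"
  using mug_pos by (simp add: const_L_def const_Lz_def field_simps power2_eq_square)

lemma Lz_nonneg: "0 \<le> Lz"
  using constants mug_pos by (simp add: const_Lz_def)

lemma Ly_pos: "0 < Ly"
  using constants mug_pos by (simp add: const_Ly_def)

lemma L_nonneg: "0 \<le> L"
  using constants mug_pos Lz_nonneg unfolding const_L_factor by simp

lemma smooth_outer_obj: "smooth L (outer_obj f g)"
  unfolding smooth_def
proof
  show "outer_obj f g differentiable_on UNIV"
    using GDERIV_outer_obj unfolding gderiv_def differentiable_on_def differentiable_def by auto
  show "L-lipschitz_on UNIV (gradient (outer_obj f g))"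
  proof (rule lipschitz_onI)
    fix x x'
    have "norm (hyper x (y_star g x) - hyper x' (y_star g x'))
        \<le> (Lf + Mg * B / mug + Lg' * Lz) * ((1 + Lg' / mug) * norm (x - x'))"
      using constants mug_pos Lz_nonneg
      by (intro order_trans[OF hyper_lipschitz] mult_left_mono graph_y_star_lipschitz) auto
    then show "dist (gradient (outer_obj f g) x) (gradient (outer_obj f g) x') \<le> L * dist x x'"
      by (simp add: gradient_eqI[OF GDERIV_outer_obj] dist_norm const_L_factor mult.assoc)
  qed (rule L_nonneg)
qed

text \<open>Insert \<open>hyper x y\<close>: the \<open>y\<close> error passes through
  \<open>hyper\<close>, while the \<open>z\<close> error enters linearly through the cross
  Hessian.\<close>

lemma hyper_gradient_error:
  "norm (grad_x f x y + hess_xy g x y *v z - gradient (outer_obj f g) x)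
    \<le> Lpsi * norm (y - y_star g x) + Lg' * norm (z - z_star f g x y)"
proof -
  let ?y = "y_star g x"
  have "norm (grad_x f x y + hess_xy g x y *v z - gradient (outer_obj f g) x)
      = norm ((hyper x y - hyper x ?y) + hess_xy g x y *v (z - z_star f g x y))"
    by (simp add: gradient_eqI[OF GDERIV_outer_obj] hyper_def matrix_vector_mult_diff_distrib
        algebra_simps)
  also have "\<dots> \<le> norm (hyper x y - hyper x ?y) + norm (hess_xy g x y *v (z - z_star f g x y))"
    by (rule norm_triangle_ineq)
  also have "norm (hyper x y - hyper x ?y) \<le> (Lf + Mg * B / mug + Lg' * Lz) * norm (y - ?y)"
    using hyper_lipschitz[of x y x ?y] by (simp add: norm_Pair)
  also have "\<dots> \<le> Lpsi * norm (y - ?y)"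
    by (intro mult_right_mono) (auto simp: const_Lpsi_def)
  also have "norm (hess_xy g x y *v (z - z_star f g x y)) \<le> Lg' * norm (z - z_star f g x y)"
    by (rule hess_xy_norm_le)
  finally show ?thesis
    by simp
qed

section \<open>Linear convergence of the inner loops\<close>

text \<open>\<open>mug \<le> Lg\<close> keeps the factor nonnegative, so that the one-step estimates
  can be chained.\<close>

lemma inner_y_contraction:
  assumes "mug \<le> Lg"
  shows "(norm (inner_y g (1 / Lg) T x y - y_star g x))\<^sup>2
    \<le> (1 - mug / Lg) ^ T * (norm (y - y_star g x))\<^sup>2"
proof (induction T)
  case (Suc T)
  let ?y = "inner_y g (1 / Lg) T x y"
  have "inner_y g (1 / Lg) (Suc T) x y = ?y - (1 / Lg) *\<^sub>R gradient (\<lambda>v. g (x, v)) ?y"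
    by (simp add: inner_y_def grad_y_def)
  then have "(norm (inner_y g (1 / Lg) (Suc T) x y - y_star g x))\<^sup>2
      \<le> (1 - mug / Lg) * (norm (?y - y_star g x))\<^sup>2"
    using gradient_step_contraction[OF smooth_g strongly_convex_g constants(3) y_star_le] by simp
  also have "\<dots> \<le> (1 - mug / Lg) * ((1 - mug / Lg) ^ T * (norm (y - y_star g x))\<^sup>2)"
    using assms constants Suc.IH by (intro mult_left_mono) auto
  finally show ?case
    by (simp add: mult.assoc)
qed (simp add: inner_y_def)

lemma inner_z_contraction:
  assumes "mug \<le> Lg"
  shows "(norm (inner_z g (1 / (2 * Lg)) N x y (grad_y f x y) z - z_star f g x y))\<^sup>2
    \<le> (1 - mug / (2 * Lg)) ^ N * (norm (z - z_star f g x y))\<^sup>2"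
proof (induction N)
  case (Suc N)
  let ?s = "z_star f g x y" and ?H = "hess_yy g x y"
  let ?z = "inner_z g (1 / (2 * Lg)) N x y (grad_y f x y) z"
  \<comment> \<open>With this substitution the residual is the Hessian applied to the error, and the
    loop becomes a linear iteration on \<open>?z - ?s\<close>.\<close>
  have "grad_y f x y = - (?H *v ?s)"
    by (simp add: hess_yy_z_star)
  then have step: "inner_z g (1 / (2 * Lg)) (Suc N) x y (grad_y f x y) z - ?s
      = (?z - ?s) - (1 / (2 * Lg)) *\<^sub>R (?H *v (?z - ?s))"
    by (simp add: inner_z_def matrix_vector_mult_diff_distrib)
  have "(norm (inner_z g (1 / (2 * Lg)) (Suc N) x y (grad_y f x y) z - ?s))\<^sup>2
      \<le> (1 - mug / (2 * Lg)) * (norm (?z - ?s))\<^sup>2"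
    unfolding step
    by (rule symmetric_step_contraction[OF matrix_vector_mul_linear hess_yy_symmetric hess_yy_ge
        hess_yy_norm_le constants(3) mug_pos])
  also have "\<dots> \<le> (1 - mug / (2 * Lg)) * ((1 - mug / (2 * Lg)) ^ N * (norm (z - ?s))\<^sup>2)"
    using assms constants Suc.IH by (intro mult_left_mono) auto
  finally show ?case
    by (simp add: mult.assoc)
qed (simp add: inner_z_def)

end

section \<open>Decrease of the potential\<close>

lemma power2_norm_add_le:
  fixes u v :: "'a::real_inner"
  shows "(norm (u + v))\<^sup>2 \<le> 2 * (norm u)\<^sup>2 + 2 * (norm v)\<^sup>2"
  using power2_norm_diff_scaleR[of u 1 v] power2_norm_diff_scaleR[of u "- 1" v]
    zero_le_power2[of "norm (u - v)"] by simp

text \<open>From \<open>1 - c \<le> exp (- c)\<close>. The square root halves the exponent, which is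
  offset by the factor 2 before the logarithms in \<open>T\<close> and \<open>N\<close>.\<close>

lemma sqrt_power_le_exp:
  fixes c :: real
  assumes "0 \<le> c" "c \<le> 1" "M \<le> c * real n"
  shows "sqrt ((1 - c) ^ n) \<le> exp (- M / 2)"
proof -
  have "(1 - c) ^ n \<le> exp (- c) ^ n"
    using assms exp_ge_add_one_self[of "- c"] by (intro power_mono) auto
  also have "\<dots> = exp (- (c * real n))"
    by (simp add: mult.commute flip: exp_of_nat_mult)
  also have "\<dots> \<le> exp (- M)"
    using assms by simp
  also have "\<dots> = (exp (- M / 2))\<^sup>2"
    by (simp flip: exp_double)
  finally show ?thesis
    by (metis exp_ge_zero real_sqrt_le_mono real_sqrt_abs abs_of_nonneg)
qed

lemma exp_le_inverse_if_ln_le: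
  fixes X :: real
  assumes "X > 0" "2 * ln X \<le> M"
  shows "exp (- M / 2) \<le> 1 / X"
proof -
  have "exp (- M / 2) \<le> exp (- ln X)"
    using assms by simp
  then show ?thesis
    using assms by (simp add: exp_minus inverse_eq_divide)
qed

text \<open>The base 0 does occur, namely for \<open>mug = Lg\<close>. Since
  \<open>0 powr 0 = 0\<close> but \<open>0 ^ 0 = 1\<close>, the exponent has to be positive.\<close>

lemma powr_half_eq_sqrt_power:
  fixes c :: real
  assumes "0 \<le> c" "n > 0"
  shows "c powr (real n / 2) = sqrt (c ^ n)"
proof (cases "c = 0")
  case False
  then have "c powr (real n / 2) = (c powr real n) powr (1 / 2)"
    by (simp add: powr_powr)
  with False assms show ?thesis
    by (simp add: powr_half_sqrt powr_realpow)
qed (use assms in simp)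

text \<open>Here \<open>F\<close> is the gap, \<open>G\<close> and \<open>E\<close> are the squared
  norms of gradient and hypergradient error, \<open>X\<close> is the squared move, and
  \<open>A\<close>, \<open>Z\<close> are the squared inner errors. By \<open>W\<close> the drift
  consumes half of the decrease \<open>G / (2 * l)\<close>; the other half gives the rate through
  \<open>PL\<close>. By \<open>cA\<close> and \<open>cZ\<close> the remaining terms fit into half of
  each weight.\<close>

lemma lyapunov_step_arith:
  fixes F F' A A' Z Z' G E X l m q s cp cg cy cz a b :: real
  assumes descent: "F' \<le> F - G / (2 * l) + E / (2 * l)"
    and err: "E \<le> 2 * cp\<^sup>2 * q * A + 2 * cg\<^sup>2 * s * Z"
    and move: "X \<le> 2 / l\<^sup>2 * (G + E)"
    and driftA: "A' \<le> 2 * q * A + 2 * cy\<^sup>2 * X"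
    and driftZ: "Z' \<le> 2 * s * Z + 2 * cz\<^sup>2 * X + 8 * cz\<^sup>2 * A'"
    and PL: "2 * m * F \<le> G"
    and W: "2 * a * cy\<^sup>2 + 2 * b * cz\<^sup>2 * (1 + 8 * cy\<^sup>2) \<le> l / 8"
    and cA: "3 / (2 * l) * cp\<^sup>2 * q + 2 * q * a + 16 * b * cz\<^sup>2 * q \<le> a / 2"
    and cZ: "3 / (2 * l) * cg\<^sup>2 * s + 2 * s * b \<le> b / 2"
    and pos: "0 < m" "m \<le> l" "0 \<le> a" "0 \<le> b" "0 \<le> A" "0 \<le> Z" "0 \<le> X"
  shows "F' + a * A' + b * Z' \<le> (1 - m / (2 * l)) * (F + a * A + b * Z)"
proof -
  have l: "l > 0"
    using pos by simp
  let ?W = "2 * a * cy\<^sup>2 + 2 * b * cz\<^sup>2 * (1 + 8 * cy\<^sup>2)"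
  have "Z' \<le> 2 * s * Z + 2 * cz\<^sup>2 * X + 8 * cz\<^sup>2 * (2 * q * A + 2 * cy\<^sup>2 * X)"
    using driftZ mult_left_mono[OF driftA, of "8 * cz\<^sup>2"] by simp
  then have "a * A' + b * Z' \<le> a * (2 * q * A + 2 * cy\<^sup>2 * X)
      + b * (2 * s * Z + 2 * cz\<^sup>2 * X + 8 * cz\<^sup>2 * (2 * q * A + 2 * cy\<^sup>2 * X))"
    using driftA pos by (intro add_mono mult_left_mono) auto
  also have "\<dots> = (2 * q * a + 16 * b * cz\<^sup>2 * q) * A + 2 * s * b * Z + ?W * X"
    by (simp add: algebra_simps)
  also have "?W * X \<le> l / 8 * (2 / l\<^sup>2 * (G + E))"
    using W move pos l by (intro mult_mono) auto
  also have "\<dots> = (G + E) / (4 * l)"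
    using l by (simp add: field_simps power2_eq_square)
  \<comment> \<open>The coefficient of \<open>E\<close> is \<open>1 / (2 * l)\<close> from the
    descent plus \<open>1 / (4 * l)\<close> from the drift.\<close>
  finally have 1: "F' + a * A' + b * Z'
      \<le> F - G / (4 * l) + 3 / (4 * l) * E + (2 * q * a + 16 * b * cz\<^sup>2 * q) * A + 2 * s * b * Z"
    using descent l by (simp add: field_simps)
  have 2: "3 / (4 * l) * E \<le> 3 / (4 * l) * (2 * cp\<^sup>2 * q * A + 2 * cg\<^sup>2 * s * Z)"
    using err l by (intro mult_left_mono) auto
  have 3: "(2 * m * F) / (4 * l) \<le> G / (4 * l)"
    using PL l by (intro divide_right_mono) auto
  have 4: "(3 / (2 * l) * cp\<^sup>2 * q + 2 * q * a + 16 * b * cz\<^sup>2 * q) * A \<le> a / 2 * A"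
    using cA pos by (intro mult_right_mono) auto
  have 5: "(3 / (2 * l) * cg\<^sup>2 * s + 2 * s * b) * Z \<le> b / 2 * Z"
    using cZ pos by (intro mult_right_mono) auto
  have "m / (2 * l) \<le> 1 / 2"
    using pos l by (simp add: field_simps)
  then have 6: "1 / 2 * (a * A + b * Z) \<le> (1 - m / (2 * l)) * (a * A + b * Z)"
    using pos by (intro mult_right_mono) auto
  have "F' + a * A' + b * Z' \<le> F - (2 * m * F) / (4 * l)
      + 3 / (4 * l) * (2 * cp\<^sup>2 * q * A + 2 * cg\<^sup>2 * s * Z)
      + (2 * q * a + 16 * b * cz\<^sup>2 * q) * A + 2 * s * b * Z"
    using 1 2 3 by linarith
  also have "\<dots> = (1 - m / (2 * l)) * F
      + (3 / (2 * l) * cp\<^sup>2 * q + 2 * q * a + 16 * b * cz\<^sup>2 * q) * A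
      + (3 / (2 * l) * cg\<^sup>2 * s + 2 * s * b) * Z"
    using l by (simp add: field_simps)
  also have "\<dots> \<le> (1 - m / (2 * l)) * F + a / 2 * A + b / 2 * Z"
    using 4 5 by linarith
  also have "\<dots> \<le> (1 - m / (2 * l)) * (F + a * A + b * Z)"
    using 6 by (simp add: algebra_simps)
  finally show ?thesis .
qed

lemma max_C_nonneg: "0 \<le> max_C Lf B Lg' Mg mug mu"
proof -
  have "0 \<le> Max {0, u, v}" for u v :: real
    by simp
  also have "Max {0, u, v} \<le> Max {w, x, Max {0, u, v}}" for u v w x :: real
    by (rule Max_ge) blast+
  finally show ?thesis
    unfolding max_C_def Let_def .
qed

lemma max_C'_nonneg: "0 \<le> max_C' Lf B Lg' Mg mug mu"
proof -
  have "0 \<le> Max {0, u, v}" for u v :: real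
    by simp
  also have "Max {0, u, v} \<le> Max {w, x, Max {0, u, v}}" for u v w x :: real
    by (rule Max_ge) blast+
  finally show ?thesis
    unfolding max_C'_def Let_def .
qed

locale bilevel_strongly_convex = bilevel f g Lf B Lg Lg' Mg mug
  for f g :: "(real^'m) \<times> (real^'n) \<Rightarrow> real" and Lf B Lg Lg' Mg mug +
  fixes mu :: real
  assumes mug_le: "mug \<le> Lg" and mu_pos: "0 < mu" and mu_le: "mu \<le> const_L Lf B Lg' Mg mug"
    and outer_strongly_convex: "strongly_convex mu (outer_obj f g)"
begin

abbreviation "T \<equiv> num_T Lf B Lg Lg' Mg mug mu"
abbreviation "N \<equiv> num_N Lf B Lg Lg' Mg mug mu"
abbreviation "MC \<equiv> max_C Lf B Lg' Mg mug mu"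
abbreviation "MC' \<equiv> max_C' Lf B Lg' Mg mug mu"

text \<open>\<open>q\<close> and \<open>s\<close> contract the squared inner errors; \<open>s'\<close> is the slower rate whose square root
  enters \<open>b\<^sub>0\<close>. The weights \<open>a\<close> and \<open>b\<close> are \<open>a\<^sub>0\<close> and \<open>b\<^sub>0\<close>, so that the initial potential is at
  most \<open>E0_tot\<close>.\<close>

definition "q = (1 - mug / Lg) ^ T"
definition "s = (1 - mug / (2 * Lg)) ^ N"
definition "s' = (1 - mug / (4 * Lg)) ^ N"
definition "a = mu / L * sqrt q"
definition "b = mu / L * sqrt s'"

section \<open>What the prescribed numbers of inner iterations guarantee\<close>

lemma L_pos: "0 < L"
  using mu_pos mu_le by linarith

lemma Lpsi_ge: "Lg' \<le> Lpsi"
  by (simp add: const_Lpsi_def)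

lemma Lpsi_pos: "0 < Lpsi"
  using Lpsi_ge constants by linarith

lemma ratio_bounds: "0 < mu / L" "mu / L \<le> 1"
  using mu_pos mu_le L_pos by simp_all

lemma MC_ge:
  "2 * ln (6 + 24 * Lpsi\<^sup>2 / mu) \<le> MC" "2 * ln (1 + 64 * Ly\<^sup>2 / L) \<le> MC"
proof -
  \<comment> \<open>This evaluates the maximum in \<open>C2\<close> and is the origin of the
    constant 64.\<close>
  have "max mu (8 * (2 * L)) = 16 * L"
    using mu_le L_pos by simp
  then have "4 * Ly\<^sup>2 / L\<^sup>2 * max mu (8 * (2 * L)) = 64 * Ly\<^sup>2 / L"
    using L_pos by (simp add: field_simps power2_eq_square)
  then have "2 * ln (1 + 64 * Ly\<^sup>2 / L) = 2 * ln (1 + 4 * Ly\<^sup>2 / L\<^sup>2 * max mu (8 * (2 * L)))"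
    by (simp only:)
  also have "\<dots> \<le> MC"
    unfolding max_C_def Let_def by (rule Max_ge) blast+
  finally show "2 * ln (1 + 64 * Ly\<^sup>2 / L) \<le> MC" .
  have "1 + 2 * ln (6 + 24 * Lpsi\<^sup>2 / mu) \<le> MC"
    unfolding max_C_def Let_def by (rule Max_ge) blast+
  then show "2 * ln (6 + 24 * Lpsi\<^sup>2 / mu) \<le> MC"
    by linarith
qed

lemma MC'_ge:
  "2 * ln (4 + 24 * Lpsi\<^sup>2 / mu) \<le> MC'"
  "2 * ln (1 + 2 * Lz\<^sup>2 / Ly\<^sup>2 * (1 + 16 * Ly\<^sup>2)) \<le> MC'"
proof -
  have "1 + 2 * ln (4 + 24 * Lpsi\<^sup>2 / mu) \<le> MC'"
    unfolding max_C'_def Let_def by (rule Max_ge) blast+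
  then show "2 * ln (4 + 24 * Lpsi\<^sup>2 / mu) \<le> MC'"
    by linarith
  show "2 * ln (1 + 2 * Lz\<^sup>2 / Ly\<^sup>2 * (1 + 16 * Ly\<^sup>2)) \<le> MC'"
    unfolding max_C'_def Let_def by (rule Max_ge) blast+
qed

lemma T_ge: "MC \<le> mug / Lg * real T"
proof -
  have "Lg / mug * MC \<le> real T"
    unfolding num_T_def Let_def by simp linarith
  then have "mug / Lg * (Lg / mug * MC) \<le> mug / Lg * real T"
    using constants mug_pos by (intro mult_left_mono) auto
  then show ?thesis
    using constants mug_pos by simp
qed

text \<open>The prefactor of \<open>N\<close> is \<open>4 * Lg / mug\<close>, twice the reciprocal
  of the loop rate, so the bound holds even for the slower rate behind \<open>s'\<close>.\<close>

lemma N_ge: "MC + MC' \<le> mug / (4 * Lg) * real N"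
proof -
  have "4 * Lg / mug * (MC + MC') \<le> real N"
    unfolding num_N_def Let_def by simp linarith
  then have "mug / (4 * Lg) * (4 * Lg / mug * (MC + MC')) \<le> mug / (4 * Lg) * real N"
    using constants mug_pos by (intro mult_left_mono) auto
  then show ?thesis
    using constants mug_pos by simp
qed

lemma q_nonneg: "0 \<le> q" and s'_nonneg: "0 \<le> s'" and s_le_s': "s \<le> s'"
proof -
  have "mug / Lg \<le> 1" "mug / (2 * Lg) \<le> 1" "mug / (4 * Lg) \<le> 1" "mug / (4 * Lg) \<le> mug / (2 * Lg)"
    using constants mug_pos mug_le by (simp_all add: field_simps)
  then show "0 \<le> q" "0 \<le> s'" "s \<le> s'"
    unfolding q_def s_def s'_def by (simp_all add: power_mono)
qed

lemma sqrt_q_le_exp: "sqrt q \<le> exp (- MC / 2)"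
  unfolding q_def using T_ge constants mug_pos mug_le by (intro sqrt_power_le_exp) auto

lemma sqrt_s'_le_exp: "sqrt s' \<le> exp (- MC / 2) * exp (- MC' / 2)"
proof -
  have "sqrt s' \<le> exp (- (MC + MC') / 2)"
    unfolding s'_def using N_ge constants mug_pos mug_le by (intro sqrt_power_le_exp) auto
  also have "\<dots> = exp (- MC / 2) * exp (- MC' / 2)"
    by (simp add: exp_add[symmetric] add_divide_distrib diff_divide_distrib)
  finally show ?thesis .
qed

text \<open>\<open>MC\<close> is at least twice each logarithm used, so
  \<open>exp (- MC / 2)\<close> is at most the reciprocal of its argument; single summands of that
  argument give the thresholds.\<close>

lemma exp_MC_le:
  "exp (- MC / 2) \<le> 1 / 6" "exp (- MC / 2) \<le> mu / (24 * Lpsi\<^sup>2)" "exp (- MC / 2) * Ly\<^sup>2 \<le> L / 64"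
proof -
  have pos: "0 < Lpsi\<^sup>2 / mu" "0 \<le> Ly\<^sup>2 / L"
    using Lpsi_pos mu_pos L_pos by simp_all
  have 1: "exp (- MC / 2) \<le> 1 / (6 + 24 * Lpsi\<^sup>2 / mu)"
    using MC_ge pos by (intro exp_le_inverse_if_ln_le) (auto intro: add_pos_pos)
  have 2: "exp (- MC / 2) \<le> 1 / (1 + 64 * Ly\<^sup>2 / L)"
    using MC_ge pos by (intro exp_le_inverse_if_ln_le) (auto intro: add_pos_nonneg)
  have "1 / (6 + 24 * Lpsi\<^sup>2 / mu) \<le> 1 / 6"
    using pos by (intro divide_left_mono) auto
  with 1 show "exp (- MC / 2) \<le> 1 / 6"
    by linarith
  have "1 / (6 + 24 * Lpsi\<^sup>2 / mu) \<le> 1 / (24 * Lpsi\<^sup>2 / mu)"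
    using Lpsi_pos mu_pos by (intro frac_le) auto
  with 1 show "exp (- MC / 2) \<le> mu / (24 * Lpsi\<^sup>2)"
    by simp
  have "exp (- MC / 2) * Ly\<^sup>2 \<le> 1 / (1 + 64 * Ly\<^sup>2 / L) * Ly\<^sup>2"
    using 2 by (intro mult_right_mono) auto
  also have "\<dots> \<le> 1 / (64 * Ly\<^sup>2 / L) * Ly\<^sup>2"
    using Ly_pos L_pos by (intro mult_right_mono frac_le) auto
  also have "\<dots> = L / 64"
    using Ly_pos by simp
  finally show "exp (- MC / 2) * Ly\<^sup>2 \<le> L / 64" .
qed

text \<open>The third bound exchanges the cost of a moving \<open>z\<close> target for
  \<open>Ly\<^sup>2\<close>, after which \<open>exp (- MC / 2)\<close> treats it like the cost of a
  moving \<open>y\<close> target.\<close>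

lemma exp_MC'_le:
  "exp (- MC' / 2) \<le> mu / (24 * Lpsi\<^sup>2)" "exp (- MC' / 2) \<le> 1 / 4"
  "exp (- MC' / 2) * (2 * Lz\<^sup>2 * (1 + 16 * Ly\<^sup>2)) \<le> Ly\<^sup>2"
proof -
  have pos: "0 < Lpsi\<^sup>2 / mu"
    using Lpsi_pos mu_pos by simp
  have 1: "exp (- MC' / 2) \<le> 1 / (4 + 24 * Lpsi\<^sup>2 / mu)"
    using MC'_ge pos by (intro exp_le_inverse_if_ln_le) (auto intro: add_pos_pos)
  have "1 / (4 + 24 * Lpsi\<^sup>2 / mu) \<le> 1 / 4"
    using pos by (intro divide_left_mono) auto
  with 1 show "exp (- MC' / 2) \<le> 1 / 4"
    by linarith
  have "1 / (4 + 24 * Lpsi\<^sup>2 / mu) \<le> 1 / (24 * Lpsi\<^sup>2 / mu)"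
    using Lpsi_pos mu_pos by (intro frac_le) auto
  with 1 show "exp (- MC' / 2) \<le> mu / (24 * Lpsi\<^sup>2)"
    by simp
  let ?X = "2 * Lz\<^sup>2 / Ly\<^sup>2 * (1 + 16 * Ly\<^sup>2)"
  have X: "0 \<le> ?X"
    by simp
  have "exp (- MC' / 2) \<le> 1 / (1 + ?X)"
    using MC'_ge X by (intro exp_le_inverse_if_ln_le) (auto intro: add_pos_nonneg)
  then have "exp (- MC' / 2) * ?X \<le> 1 / (1 + ?X) * ?X"
    using X by (rule mult_right_mono)
  also have "\<dots> = ?X / (1 + ?X)"
    by (rule mult.commute[THEN trans]) simp
  also have "\<dots> \<le> 1"
    using X by (subst divide_le_eq_1_pos) (auto intro: add_pos_nonneg)
  finally have "exp (- MC' / 2) * ?X * Ly\<^sup>2 \<le> 1 * Ly\<^sup>2"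
    by (rule mult_right_mono) simp
  moreover have "?X * Ly\<^sup>2 = 2 * Lz\<^sup>2 * (1 + 16 * Ly\<^sup>2)"
    using Ly_pos by simp
  ultimately show "exp (- MC' / 2) * (2 * Lz\<^sup>2 * (1 + 16 * Ly\<^sup>2)) \<le> Ly\<^sup>2"
    by (simp only: mult.assoc[of "exp (- MC' / 2)" ?X] mult_1)
qed

section \<open>The three conditions on the weights\<close>

lemma a_nonneg: "0 \<le> a" and b_nonneg: "0 \<le> b"
  using mu_pos L_pos q_nonneg s'_nonneg by (simp_all add: a_def b_def)

lemma a_le: "a \<le> exp (- MC / 2)"
  using mult_mono[OF ratio_bounds(2) sqrt_q_le_exp] ratio_bounds q_nonneg by (simp add: a_def)

lemma b_le: "b \<le> exp (- MC / 2) * exp (- MC' / 2)"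
  using mult_mono[OF ratio_bounds(2) sqrt_s'_le_exp] ratio_bounds s'_nonneg by (simp add: b_def)

lemma weight_movement: "2 * a * Ly\<^sup>2 + 2 * b * Lz\<^sup>2 * (1 + 8 * Ly\<^sup>2) \<le> L / 8"
proof -
  let ?P = "2 * Lz\<^sup>2 * (1 + 16 * Ly\<^sup>2)"
  have "a * Ly\<^sup>2 \<le> L / 64"
    using mult_right_mono[OF a_le, of "Ly\<^sup>2"] exp_MC_le(3) by simp
  moreover have "2 * b * Lz\<^sup>2 * (1 + 8 * Ly\<^sup>2) \<le> L / 64"
  proof -
    have "2 * b * Lz\<^sup>2 * (1 + 8 * Ly\<^sup>2) = b * (2 * Lz\<^sup>2 * (1 + 8 * Ly\<^sup>2))"
      by simp
    also have "\<dots> \<le> b * ?P"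
      using b_nonneg by (intro mult_left_mono) auto
    also have "\<dots> \<le> exp (- MC / 2) * exp (- MC' / 2) * ?P"
      using b_le by (rule mult_right_mono) simp
    also have "\<dots> = exp (- MC / 2) * (exp (- MC' / 2) * ?P)"
      by simp
    also have "\<dots> \<le> exp (- MC / 2) * Ly\<^sup>2"
      using exp_MC'_le(3) by (rule mult_left_mono) simp
    also note exp_MC_le(3)
    finally show ?thesis .
  qed
  ultimately show ?thesis
    using L_pos by simp
qed

text \<open>Each term on the left contains \<open>q\<close>, the right side only
  \<open>sqrt q\<close>. After cancelling \<open>sqrt q\<close> the three terms take at most 1/16,
  1/18 and 1/12 of \<open>mu / L\<close>, together less than 1/2.\<close>

lemma weight_y: "3 / (2 * L) * Lpsi\<^sup>2 * q + 2 * q * a + 16 * b * Lz\<^sup>2 * q \<le> a / 2"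
proof -
  let ?r = "sqrt q" and ?d = "mu / L"
  have r: "0 \<le> ?r" "?r \<le> 1 / 6" "?r \<le> mu / (24 * Lpsi\<^sup>2)"
    using q_nonneg sqrt_q_le_exp exp_MC_le by (auto intro: order_trans)
  have q: "q = ?r * ?r"
    using q_nonneg by simp
  have 1: "3 / (2 * L) * Lpsi\<^sup>2 * ?r \<le> ?d / 16"
  proof -
    have "3 / (2 * L) * Lpsi\<^sup>2 * ?r \<le> 3 / (2 * L) * Lpsi\<^sup>2 * (mu / (24 * Lpsi\<^sup>2))"
      using r L_pos by (intro mult_left_mono) auto
    also have "\<dots> = ?d / 16"
      using Lpsi_pos L_pos by (simp add: field_simps)
    finally show ?thesis .
  qed
  have "2 * ?r * a = ?d * (2 * (?r * ?r))"
    by (simp add: a_def)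
  also have "\<dots> \<le> ?d * (2 * (1 / 6 * (1 / 6)))"
    using r ratio_bounds by (intro mult_left_mono mult_mono) auto
  finally have 2: "2 * ?r * a \<le> ?d / 18"
    by simp
  have "16 * Lz\<^sup>2 * exp (- MC' / 2) \<le> 1 / 2"
  proof -
    \<comment> \<open>Keeping only the summand \<open>16 * Ly\<^sup>2\<close> makes
      \<open>Ly\<^sup>2\<close> cancel.\<close>
    have "exp (- MC' / 2) * (2 * Lz\<^sup>2 * (16 * Ly\<^sup>2)) \<le> exp (- MC' / 2) * (2 * Lz\<^sup>2 * (1 + 16 * Ly\<^sup>2))"
      by (intro mult_left_mono) auto
    also note exp_MC'_le(3)
    finally have "(32 * Lz\<^sup>2 * exp (- MC' / 2)) * Ly\<^sup>2 \<le> 1 * Ly\<^sup>2"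
      by (simp add: mult_ac)
    then show ?thesis
      using Ly_pos by (subst (asm) mult_le_cancel_right) simp
  qed
  moreover have "exp (- MC / 2) \<le> 1"
    using max_C_nonneg by simp
  ultimately have "exp (- MC / 2) * (16 * Lz\<^sup>2 * exp (- MC' / 2)) \<le> 1 * (1 / 2)"
    by (intro mult_mono) auto
  moreover have "sqrt s' * (16 * Lz\<^sup>2) \<le> exp (- MC / 2) * exp (- MC' / 2) * (16 * Lz\<^sup>2)"
    using sqrt_s'_le_exp by (rule mult_right_mono) simp
  ultimately have 0: "sqrt s' * (16 * Lz\<^sup>2) \<le> 1 / 2"
    by (simp add: mult_ac)
  have "16 * b * Lz\<^sup>2 * ?r = ?d * (sqrt s' * (16 * Lz\<^sup>2) * ?r)"
    by (simp add: b_def)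
  also have "\<dots> \<le> ?d * (1 / 2 * (1 / 6))"
    using r ratio_bounds 0 by (intro mult_left_mono mult_mono) auto
  finally have 3: "16 * b * Lz\<^sup>2 * ?r \<le> ?d / 12"
    by simp
  have "u + v + w \<le> d / 2" if "u \<le> d / 16" "v \<le> d / 18" "w \<le> d / 12" "0 < d" for u v w d :: real
    using that by linarith
  from this[OF 1 2 3 ratio_bounds(1)]
  have "3 / (2 * L) * Lpsi\<^sup>2 * ?r + 2 * ?r * a + 16 * b * Lz\<^sup>2 * ?r \<le> ?d / 2" .
  then have "(3 / (2 * L) * Lpsi\<^sup>2 * ?r + 2 * ?r * a + 16 * b * Lz\<^sup>2 * ?r) * ?r \<le> ?d / 2 * ?r"
    using r by (intro mult_right_mono) auto
  also have "?d / 2 * ?r = a / 2"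
    by (simp add: a_def)
  also have "(3 / (2 * L) * Lpsi\<^sup>2 * ?r + 2 * ?r * a + 16 * b * Lz\<^sup>2 * ?r) * ?r
      = 3 / (2 * L) * Lpsi\<^sup>2 * (?r * ?r) + 2 * (?r * ?r) * a + 16 * b * Lz\<^sup>2 * (?r * ?r)"
    by (simp only: distrib_left distrib_right mult_ac)
  finally show ?thesis
    unfolding q[symmetric] .
qed

text \<open>As for \<open>y\<close>, but \<open>s\<close> is first enlarged to \<open>s'\<close>,
  whose root is the one contained in \<open>b\<close>; \<open>Lg' \<le> Lpsi\<close> makes the
  threshold for \<open>Lpsi\<close> applicable.\<close>

lemma weight_z: "3 / (2 * L) * Lg'\<^sup>2 * s + 2 * s * b \<le> b / 2"
proof -
  let ?r = "sqrt s'" and ?d = "mu / L"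
  have "?r \<le> 1 / 6 * (1 / 4)" "?r \<le> 1 / 6 * (mu / (24 * Lpsi\<^sup>2))"
    using order_trans[OF sqrt_s'_le_exp mult_mono[OF exp_MC_le(1) exp_MC'_le(2)]]
      order_trans[OF sqrt_s'_le_exp mult_mono[OF exp_MC_le(1) exp_MC'_le(1)]] by simp_all
  then have r: "0 \<le> ?r" "?r \<le> 1 / 24" "?r \<le> mu / (144 * Lpsi\<^sup>2)"
    using s'_nonneg by auto
  have s': "s' = ?r * ?r"
    using s'_nonneg by simp
  have "Lg'\<^sup>2 \<le> Lpsi\<^sup>2"
    using Lpsi_ge constants by (intro power_mono) auto
  then have "3 / (2 * L) * Lg'\<^sup>2 * ?r \<le> 3 / (2 * L) * Lpsi\<^sup>2 * (mu / (144 * Lpsi\<^sup>2))"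
    using r L_pos by (intro mult_mono) auto
  also have "\<dots> = ?d / 96"
    using Lpsi_pos L_pos by (simp add: field_simps)
  finally have 1: "3 / (2 * L) * Lg'\<^sup>2 * ?r \<le> ?d / 96" .
  have "2 * ?r * b = ?d * (2 * (?r * ?r))"
    by (simp add: b_def)
  also have "\<dots> \<le> ?d * (2 * (1 / 24 * (1 / 24)))"
    using r ratio_bounds by (intro mult_left_mono mult_mono) auto
  finally have 2: "2 * ?r * b \<le> ?d / 288"
    by simp
  have "(3 / (2 * L) * Lg'\<^sup>2 + 2 * b) * s \<le> (3 / (2 * L) * Lg'\<^sup>2 + 2 * b) * s'"
    using s_le_s' L_pos b_nonneg by (intro mult_left_mono) auto
  also have "\<dots> = (3 / (2 * L) * Lg'\<^sup>2 * ?r + 2 * ?r * b) * ?r"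
    by (subst s') (simp add: algebra_simps)
  also have "\<dots> \<le> ?d / 2 * ?r"
  proof (rule mult_right_mono[OF _ r(1)])
    have "u + v \<le> d / 2" if "u \<le> d / 96" "v \<le> d / 288" "0 < d" for u v d :: real
      using that by linarith
    from this[OF 1 2 ratio_bounds(1)]
    show "3 / (2 * L) * Lg'\<^sup>2 * ?r + 2 * ?r * b \<le> ?d / 2" .
  qed
  finally show ?thesis
    by (simp add: b_def algebra_simps)
qed

section \<open>The potential along the outer iteration\<close>

abbreviation "F \<equiv> outer_obj f g"

lemma F_min: "F (x_star f g) \<le> F x"
  unfolding x_star_def
  using strongly_convex_arg_min[OF outer_strongly_convex mu_pos, of x] smooth_outer_obj
  by (simp add: smooth_def)

lemma GDERIV_F: "GDERIV F x :> gradient F x"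
  using GDERIV_outer_obj by (metis gradient_eqI)

text \<open>The tangent bound at the minimizer, where the gradient vanishes; it lets the potential
  do without a distance term.\<close>

lemma distance_to_minimizer_le: "mu / 2 * (norm (x - x_star f g))\<^sup>2 \<le> F x - F (x_star f g)"
  using strongly_convex_above_tangent[OF outer_strongly_convex GDERIV_F, of "x_star f g" x]
    GDERIV_at_minimum[OF GDERIV_F F_min] by simp

text \<open>A state holds the warm starts for its \<open>x\<close>, so the \<open>z\<close> error is
  measured against the target at the \<open>y\<close> that the next inner loop will compute.\<close>

definition potential :: "(real^'m) \<times> (real^'n) \<times> (real^'n) \<Rightarrow> real" where
  "potential = (\<lambda>(x, y, z). F x - F (x_star f g) + a * (norm (y - y_star g x))\<^sup>2
     + b * (norm (z - z_star f g x (inner_y g (1 / Lg) T x y)))\<^sup>2)"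

lemma potential_step:
  assumes y: "y = inner_y g (1 / Lg) T x yp"
    and z: "z = inner_z g (1 / (2 * Lg)) N x y (grad_y f x y) zp"
    and x': "x' = x - (1 / L) *\<^sub>R (grad_x f x y + hess_xy g x y *v z)"
  shows "potential (x', y, z) \<le> (1 - mu / (2 * L)) * potential (x, yp, zp)"
proof -
  define \<psi> where "\<psi> = grad_x f x y + hess_xy g x y *v z"
  define D where "D = gradient F x"
  define y' where "y' = inner_y g (1 / Lg) T x' y"
  let ?A = "(norm (yp - y_star g x))\<^sup>2" and ?A' = "(norm (y - y_star g x'))\<^sup>2"
  let ?Z = "(norm (zp - z_star f g x y))\<^sup>2" and ?Z' = "(norm (z - z_star f g x' y'))\<^sup>2"
  let ?X = "(norm (x' - x))\<^sup>2"
  have cy: "(norm (y - y_star g x))\<^sup>2 \<le> q * ?A"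
    unfolding y q_def by (rule inner_y_contraction[OF mug_le])
  have cz: "(norm (z - z_star f g x y))\<^sup>2 \<le> s * ?Z"
    unfolding z s_def by (rule inner_z_contraction[OF mug_le])
  have q1: "q \<le> 1"
    unfolding q_def using constants mug_pos mug_le by (intro power_le_one) auto
  have descent: "F x' - F (x_star f g)
      \<le> F x - F (x_star f g) - (norm D)\<^sup>2 / (2 * L) + (norm (\<psi> - D))\<^sup>2 / (2 * L)"
  proof -
    have "F x' \<le> F x + ((- (1 / L) *\<^sub>R \<psi>) \<bullet> D + L / 2 * (norm (- (1 / L) *\<^sub>R \<psi>))\<^sup>2)"
      using smooth_descent[OF smooth_outer_obj, of x "- (1 / L) *\<^sub>R \<psi>"]
      by (simp add: x' \<psi>_def D_def)
    also have "(- (1 / L) *\<^sub>R \<psi>) \<bullet> D + L / 2 * (norm (- (1 / L) *\<^sub>R \<psi>))\<^sup>2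
        = ((norm \<psi>)\<^sup>2 - 2 * (\<psi> \<bullet> D)) / (2 * L)"
      using L_pos by (simp add: power_divide power2_eq_square[of L] field_simps)
    \<comment> \<open>Polarization replaces the cross term by the norms of the gradient and of the
      error.\<close>
    also have "\<dots> = - (norm D)\<^sup>2 / (2 * L) + (norm (\<psi> - D))\<^sup>2 / (2 * L)"
      using power2_norm_diff_scaleR[of \<psi> 1 D] by (simp add: diff_divide_distrib add_divide_distrib)
    finally show ?thesis
      by simp
  qed
  have err: "(norm (\<psi> - D))\<^sup>2 \<le> 2 * Lpsi\<^sup>2 * q * ?A + 2 * Lg'\<^sup>2 * s * ?Z"
  proof -
    let ?u = "Lpsi * norm (y - y_star g x)" and ?v = "Lg' * norm (z - z_star f g x y)"
    have "norm (\<psi> - D) \<le> ?u + ?v"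
      unfolding \<psi>_def D_def by (rule hyper_gradient_error)
    then have "(norm (\<psi> - D))\<^sup>2 \<le> (?u + ?v)\<^sup>2"
      by (rule power_mono) simp
    also have "\<dots> \<le> 2 * ?u\<^sup>2 + 2 * ?v\<^sup>2"
      using power2_norm_add_le[of ?u ?v] by simp
    also have "\<dots> = 2 * Lpsi\<^sup>2 * (norm (y - y_star g x))\<^sup>2 + 2 * Lg'\<^sup>2 * (norm (z - z_star f g x y))\<^sup>2"
      by (simp add: power_mult_distrib)
    also have "\<dots> \<le> 2 * Lpsi\<^sup>2 * (q * ?A) + 2 * Lg'\<^sup>2 * (s * ?Z)"
      using cy cz by (intro add_mono mult_left_mono) auto
    finally show ?thesis
      by (simp add: mult.assoc)
  qed
  have move: "?X \<le> 2 / L\<^sup>2 * ((norm D)\<^sup>2 + (norm (\<psi> - D))\<^sup>2)"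
  proof -
    have "?X = (norm \<psi>)\<^sup>2 / L\<^sup>2"
      using L_pos by (simp add: x' \<psi>_def power_divide)
    also have "\<dots> \<le> (2 * (norm D)\<^sup>2 + 2 * (norm (\<psi> - D))\<^sup>2) / L\<^sup>2"
      using power2_norm_add_le[of D "\<psi> - D"] by (intro divide_right_mono) auto
    finally show ?thesis
      by (simp add: algebra_simps add_divide_distrib)
  qed
  have driftA: "?A' \<le> 2 * q * ?A + 2 * Ly\<^sup>2 * ?X"
  proof -
    have "norm (y_star g x - y_star g x') \<le> Ly * norm (x' - x)"
      using y_star_lipschitz[of x x'] by (simp add: const_Ly_def norm_minus_commute)
    then have "(norm (y_star g x - y_star g x'))\<^sup>2 \<le> Ly\<^sup>2 * ?X"
      using power_mono[of _ "Ly * norm (x' - x)" 2] by (simp add: power_mult_distrib)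
    then show ?thesis
      using power2_norm_add_le[of "y - y_star g x" "y_star g x - y_star g x'"] cy by simp
  qed
  \<comment> \<open>The target moves from \<open>(x, y)\<close> to \<open>(x', y')\<close>. Both
    \<open>y\<close> and \<open>y'\<close> lie within the root of \<open>?A'\<close> of
    \<open>y_star g x'\<close>, hence the factor 4, which doubles to 8.\<close>
  have driftZ: "?Z' \<le> 2 * s * ?Z + 2 * Lz\<^sup>2 * ?X + 8 * Lz\<^sup>2 * ?A'"
  proof -
    have "(norm (y' - y_star g x'))\<^sup>2 \<le> q * ?A'"
      unfolding y'_def q_def by (rule inner_y_contraction[OF mug_le])
    also have "\<dots> \<le> 1 * ?A'"
      using q1 by (intro mult_right_mono) auto
    finally have "(norm (y' - y_star g x'))\<^sup>2 \<le> ?A'"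
      by simp
    moreover have "(norm (y - y'))\<^sup>2 \<le> 2 * ?A' + 2 * (norm (y' - y_star g x'))\<^sup>2"
      using power2_norm_add_le[of "y - y_star g x'" "y_star g x' - y'"]
      by (simp add: norm_minus_commute)
    ultimately have "(norm (y - y'))\<^sup>2 \<le> 4 * ?A'"
      by linarith
    then have "(norm ((x, y) - (x', y')))\<^sup>2 \<le> ?X + 4 * ?A'"
      by (simp add: norm_Pair norm_minus_commute)
    moreover have "(norm (z_star f g x y - z_star f g x' y'))\<^sup>2 \<le> Lz\<^sup>2 * (norm ((x, y) - (x', y')))\<^sup>2"
      using power_mono[OF z_star_lipschitz, of x y x' y' 2] by (simp only: power_mult_distrib norm_ge_zero)
    ultimately have "(norm (z_star f g x y - z_star f g x' y'))\<^sup>2 \<le> Lz\<^sup>2 * (?X + 4 * ?A')"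
      by (meson mult_left_mono order_trans zero_le_power2)
    then show ?thesis
      using power2_norm_add_le[of "z - z_star f g x y" "z_star f g x y - z_star f g x' y'"] cz
      by (simp add: algebra_simps)
  qed
  have PL: "2 * mu * (F x - F (x_star f g)) \<le> (norm D)\<^sup>2"
    unfolding D_def by (rule strongly_convex_gradient_norm_ge[OF outer_strongly_convex GDERIV_F mu_pos])
  show ?thesis
    using lyapunov_step_arith[OF descent err move driftA driftZ PL weight_movement weight_y weight_z
        mu_pos mu_le a_nonneg b_nonneg]
    by (simp add: potential_def y y'_def)
qed

abbreviation "iterate x0 ym zm \<equiv>
  amigo f g (\<lambda>_. 1 / Lg) (\<lambda>_. 1 / (2 * Lg)) (\<lambda>_. 1 / L) T N x0 ym zm"

lemma potential_iterate_le:
  "potential (iterate x0 ym zm k) \<le> (1 - mu / (2 * L)) ^ k * potential (x0, ym, zm)"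
proof (induction k)
  case (Suc k)
  obtain x yp zp where st: "iterate x0 ym zm k = (x, yp, zp)"
    by (metis prod_cases3)
  have "potential (iterate x0 ym zm (Suc k)) \<le> (1 - mu / (2 * L)) * potential (iterate x0 ym zm k)"
    unfolding amigo.simps st Let_def prod.case by (rule potential_step) (rule refl)+
  also have "\<dots> \<le> (1 - mu / (2 * L)) * ((1 - mu / (2 * L)) ^ k * potential (x0, ym, zm))"
    using ratio_bounds Suc.IH by (intro mult_left_mono) auto
  finally show ?case
    by (simp add: mult.assoc)
qed simp

lemma error_le_potential:
  "F x - F (x_star f g) + mu / 2 * (norm (x - x_star f g))\<^sup>2 \<le> 2 * potential (x, y, z)"
proof -
  have "F x - F (x_star f g) \<le> potential (x, y, z)"
    using a_nonneg b_nonneg by (simp add: potential_def)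
  with distance_to_minimizer_le[of x] show ?thesis
    by linarith
qed

lemma potential_initial_le:
  "potential (x0, ym, zm) \<le> E0_tot f g Lf B Lg Lg' Mg mug mu x0 ym zm"
proof -
  have T: "(1 - mug / Lg) powr (real T / 2) = sqrt q"
    unfolding q_def using constants mug_pos mug_le
    by (intro powr_half_eq_sqrt_power) (auto simp: num_T_def Let_def)
  have N: "(1 - mug / (4 * Lg)) powr (real N / 2) = sqrt s'"
    unfolding s'_def using constants mug_pos mug_le
    by (intro powr_half_eq_sqrt_power) (auto simp: num_N_def Let_def)
  have "E0_tot f g Lf B Lg Lg' Mg mug mu x0 ym zm
      = mu / 2 * (norm (x0 - x_star f g))\<^sup>2 + potential (x0, ym, zm)"
    using T N by (simp add: E0_tot_def potential_def Let_def a_def b_def)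
  with mu_pos show ?thesis
    by simp
qed

lemma potential_nonneg: "0 \<le> potential w"
  using F_min a_nonneg b_nonneg by (cases w) (auto simp: potential_def)

text \<open>The contraction is at most \<open>exp (- log_err)\<close> squared: one factor brings
  \<open>E0\<close> below \<open>\<epsilon>\<close>, the other is at most 1/2 and pays for the
  factor 2 between error and potential.\<close>

lemma amigo_converges:
  fixes x0 :: "real^'m" and ym zm :: "real^'n" and \<epsilon> :: real
  assumes "\<epsilon> > 0"
  defines "E0 \<equiv> E0_tot f g Lf B Lg Lg' Mg mug mu x0 ym zm"
  defines "log_err \<equiv> max 1 (ln (E0 / \<epsilon>))"
  obtains k x where "x = fst (iterate x0 ym zm k)"
    "F x - F (x_star f g) + mu / 2 * (norm (x - x_star f g))\<^sup>2 \<le> \<epsilon>"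
    "real k \<le> 8 * (L / mu) * log_err"
proof
  \<comment> \<open>Multiplied by the rate \<open>mu / (2 * L)\<close>, this number of steps gives
    \<open>2 * log_err\<close>.\<close>
  define k where "k = nat \<lceil>4 * (L / mu) * log_err\<rceil>"
  let ?\<kappa> = "L / mu"
  have \<kappa>: "?\<kappa> \<ge> 1" and log_err: "log_err \<ge> 1"
    using mu_pos mu_le by (simp_all add: log_err_def)
  obtain y z where w: "iterate x0 ym zm k = (fst (iterate x0 ym zm k), y, z)"
    by (metis prod.collapse)
  \<comment> \<open>Hence the rounding of \<open>k\<close> is absorbed in passing from 4 to
    8.\<close>
  have "1 \<le> ?\<kappa> * log_err"
    using mult_mono[OF \<kappa> log_err] \<kappa> by simp
  then have k: "4 * ?\<kappa> * log_err \<le> real k" "real k \<le> 4 * ?\<kappa> * log_err + 1"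
    unfolding k_def by linarith+
  with \<open>1 \<le> ?\<kappa> * log_err\<close> show "real k \<le> 8 * ?\<kappa> * log_err"
    by linarith
  have "mu / (2 * L) * (4 * ?\<kappa> * log_err) \<le> mu / (2 * L) * real k"
    using k(1) mu_pos L_pos by (intro mult_left_mono) auto
  then have "2 * log_err \<le> mu / (2 * L) * real k"
    using mu_pos L_pos by simp
  then have "sqrt ((1 - mu / (2 * L)) ^ k) \<le> exp (- (2 * log_err) / 2)"
    using ratio_bounds by (intro sqrt_power_le_exp) auto
  then have "(sqrt ((1 - mu / (2 * L)) ^ k))\<^sup>2 \<le> (exp (- log_err))\<^sup>2"
    using ratio_bounds by (intro power_mono) auto
  then have rate: "(1 - mu / (2 * L)) ^ k \<le> exp (- log_err) * exp (- log_err)"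
    using ratio_bounds by (simp add: power2_eq_square)
  have "2 * exp (- log_err) \<le> 1"
  proof -
    have "2 \<le> exp log_err"
      using exp_ge_add_one_self[of log_err] log_err by linarith
    then show ?thesis
      by (simp add: exp_minus field_simps)
  qed
  have E0: "E0 * exp (- log_err) \<le> \<epsilon>"
  \<comment> \<open>\<open>E0\<close> may vanish, and then \<open>ln (E0 / \<epsilon>)\<close> is
    only a default value.\<close>
  proof (cases "E0 > 0")
    case True
    then have "E0 / \<epsilon> = exp (ln (E0 / \<epsilon>))"
      using \<open>\<epsilon> > 0\<close> by simp
    also have "\<dots> \<le> exp log_err"
      by (simp add: log_err_def)
    finally show ?thesis
      using \<open>\<epsilon> > 0\<close> by (simp add: exp_minus field_simps)
  next
    case False
    then have "E0 * exp (- log_err) \<le> 0"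
      by (simp add: mult_nonpos_nonneg)
    with \<open>\<epsilon> > 0\<close> show ?thesis
      by linarith
  qed
  have E0_pot: "0 \<le> potential (x0, ym, zm)" "potential (x0, ym, zm) \<le> E0"
    using potential_nonneg potential_initial_le by (auto simp: E0_def)
  let ?x = "fst (iterate x0 ym zm k)"
  have "F ?x - F (x_star f g) + mu / 2 * (norm (?x - x_star f g))\<^sup>2 \<le> 2 * potential (iterate x0 ym zm k)"
    using error_le_potential[of ?x y z] w by simp
  also have "\<dots> \<le> 2 * ((1 - mu / (2 * L)) ^ k * potential (x0, ym, zm))"
    using potential_iterate_le by simp
  also have "\<dots> \<le> 2 * ((exp (- log_err) * exp (- log_err)) * E0)"
    using rate E0_pot by (intro mult_left_mono mult_mono) auto
  also have "\<dots> = (2 * exp (- log_err)) * (E0 * exp (- log_err))"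
    by simp
  also have "\<dots> \<le> 1 * \<epsilon>"
    using \<open>2 * exp (- log_err) \<le> 1\<close> E0 E0_pot by (intro mult_mono) auto
  finally show "F ?x - F (x_star f g) + mu / 2 * (norm (?x - x_star f g))\<^sup>2 \<le> \<epsilon>"
    by simp
qed simp

end

section \<open>Growth of the numbers of inner iterations\<close>

locale growth_scale =
  fixes S :: "'i set" and X :: "'i \<Rightarrow> real"
  assumes scale_ge_1: "i \<in> S \<Longrightarrow> 1 \<le> X i"
begin

definition poly_bounded :: "('i \<Rightarrow> real) \<Rightarrow> bool" where
  "poly_bounded h \<longleftrightarrow> (\<exists>K\<ge>0. \<exists>n. \<forall>i\<in>S. \<bar>h i\<bar> \<le> K * X i ^ n)"

text \<open>One-sided, since a logarithm may be arbitrarily negative and only upper bounds on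
  iteration numbers are sought.\<close>

definition log_bounded :: "('i \<Rightarrow> real) \<Rightarrow> bool" where
  "log_bounded h \<longleftrightarrow> (\<exists>K\<ge>0. \<forall>i\<in>S. h i \<le> K * (1 + ln (X i)))"

lemma poly_bounded_scale: "poly_bounded X"
  unfolding poly_bounded_def using scale_ge_1
  by (intro exI[of _ 1] conjI exI[of _ "1 :: nat"]) fastforce+

lemma poly_bounded_const: "poly_bounded (\<lambda>_. c)"
  unfolding poly_bounded_def by (intro exI[of _ "\<bar>c\<bar>"] conjI exI[of _ "0 :: nat"]) auto

lemma poly_bounded_mono:
  assumes "poly_bounded g" "\<And>i. i \<in> S \<Longrightarrow> \<bar>h i\<bar> \<le> \<bar>g i\<bar>"
  shows "poly_bounded h"
  using assms unfolding poly_bounded_def by (meson order_trans)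

lemma poly_bounded_add:
  assumes "poly_bounded g" "poly_bounded h"
  shows "poly_bounded (\<lambda>i. g i + h i)"
proof -
  obtain K n K' n' where K: "K \<ge> 0" "\<And>i. i \<in> S \<Longrightarrow> \<bar>g i\<bar> \<le> K * X i ^ n"
    and K': "K' \<ge> 0" "\<And>i. i \<in> S \<Longrightarrow> \<bar>h i\<bar> \<le> K' * X i ^ n'"
    using assms unfolding poly_bounded_def by blast
  have "\<bar>g i + h i\<bar> \<le> (K + K') * X i ^ (n + n')" if i: "i \<in> S" for i
  proof -
    \<comment> \<open>A scale of at least 1 allows the common exponent
      \<open>n + n'\<close>.\<close>
    have "K * X i ^ n \<le> K * X i ^ (n + n')" "K' * X i ^ n' \<le> K' * X i ^ (n + n')"
      using K K' scale_ge_1[OF i] by (intro mult_left_mono power_increasing; simp)+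
    then show ?thesis
      using K(2)[OF i] K'(2)[OF i] by (simp add: distrib_right)
  qed
  with K K' show ?thesis
    unfolding poly_bounded_def by (intro exI[of _ "K + K'"] conjI exI[of _ "n + n'"]) auto
qed

lemma poly_bounded_mult:
  assumes "poly_bounded g" "poly_bounded h"
  shows "poly_bounded (\<lambda>i. g i * h i)"
proof -
  obtain K n K' n' where K: "K \<ge> 0" "\<And>i. i \<in> S \<Longrightarrow> \<bar>g i\<bar> \<le> K * X i ^ n"
    and K': "K' \<ge> 0" "\<And>i. i \<in> S \<Longrightarrow> \<bar>h i\<bar> \<le> K' * X i ^ n'"
    using assms unfolding poly_bounded_def by blast
  have "\<bar>g i * h i\<bar> \<le> (K * K') * X i ^ (n + n')" if i: "i \<in> S" for i
  proof -
    have "\<bar>g i * h i\<bar> \<le> (K * X i ^ n) * (K' * X i ^ n')"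
      unfolding abs_mult using K K' scale_ge_1[OF i] i by (intro mult_mono) auto
    then show ?thesis
      by (simp add: power_add mult_ac)
  qed
  with K K' show ?thesis
    unfolding poly_bounded_def by (intro exI[of _ "K * K'"] conjI exI[of _ "n + n'"]) auto
qed

lemma poly_bounded_power: "poly_bounded h \<Longrightarrow> poly_bounded (\<lambda>i. h i ^ n)"
  by (induction n) (simp_all add: poly_bounded_const poly_bounded_mult)

lemma poly_bounded_divide:
  "poly_bounded g \<Longrightarrow> poly_bounded (\<lambda>i. 1 / h i) \<Longrightarrow> poly_bounded (\<lambda>i. g i / h i)"
  using poly_bounded_mult[of g "\<lambda>i. 1 / h i"] by simp

lemma poly_bounded_recip_power: "poly_bounded (\<lambda>i. 1 / h i) \<Longrightarrow> poly_bounded (\<lambda>i. 1 / h i ^ n)"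
  using poly_bounded_power[of "\<lambda>i. 1 / h i" n] by (simp add: power_one_over)

lemma poly_bounded_recip_mult:
  "poly_bounded (\<lambda>i. 1 / g i) \<Longrightarrow> poly_bounded (\<lambda>i. 1 / h i) \<Longrightarrow> poly_bounded (\<lambda>i. 1 / (g i * h i))"
  using poly_bounded_mult[of "\<lambda>i. 1 / g i" "\<lambda>i. 1 / h i"] by simp

lemma poly_bounded_max:
  assumes "poly_bounded g" "poly_bounded h"
  shows "poly_bounded (\<lambda>i. max (g i) (h i))"
proof -
  have "poly_bounded (\<lambda>i. \<bar>g i\<bar> + \<bar>h i\<bar>)"
    using assms by (intro poly_bounded_add) (auto elim: poly_bounded_mono)
  then show ?thesis
    by (rule poly_bounded_mono) auto
qed

text \<open>The order matters: on reciprocals, the rule for quotients applies to its own second premise.\<close>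

lemmas poly_bounded_intros = poly_bounded_const poly_bounded_add poly_bounded_mult
  poly_bounded_power poly_bounded_max poly_bounded_recip_power poly_bounded_recip_mult
  poly_bounded_divide

lemma ln_scale_nonneg: "i \<in> S \<Longrightarrow> 0 \<le> ln (X i)"
  using scale_ge_1 by simp

lemma log_bounded_ln:
  assumes "poly_bounded h" "\<And>i. i \<in> S \<Longrightarrow> 0 < h i"
  shows "log_bounded (\<lambda>i. ln (h i))"
proof -
  obtain K n where K: "K \<ge> 0" "\<And>i. i \<in> S \<Longrightarrow> \<bar>h i\<bar> \<le> K * X i ^ n"
    using assms(1) unfolding poly_bounded_def by blast
  \<comment> \<open>With \<open>K + 1\<close> in place of \<open>K\<close> the logarithm is
    nonnegative even for small \<open>K\<close>.\<close>
  let ?c = "ln (K + 1) + real n"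
  have "ln (h i) \<le> ?c * (1 + ln (X i))" if i: "i \<in> S" for i
  proof -
    have X: "1 \<le> X i"
      by (rule scale_ge_1[OF i])
    have "K * X i ^ n \<le> (K + 1) * X i ^ n"
      using X by (intro mult_right_mono) auto
    then have "h i \<le> (K + 1) * X i ^ n"
      using K(2)[OF i] by linarith
    then have "ln (h i) \<le> ln ((K + 1) * X i ^ n)"
      using assms(2)[OF i] by simp
    also have "\<dots> = ln (K + 1) + real n * ln (X i)"
      using K(1) X by (simp add: ln_mult ln_realpow)
    also have "\<dots> \<le> ln (K + 1) + real n * ln (X i) + (real n + ln (K + 1) * ln (X i))"
      using K(1) ln_scale_nonneg[OF i] by simp
    finally show ?thesis
      by (simp add: algebra_simps)
  qed
  then show ?thesis
    using K(1) unfolding log_bounded_def by (intro exI[of _ ?c]) auto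
qed

lemma log_bounded_mono:
  assumes "log_bounded g" "\<And>i. i \<in> S \<Longrightarrow> h i \<le> g i"
  shows "log_bounded h"
  using assms unfolding log_bounded_def by (meson order_trans)

lemma log_bounded_const: "log_bounded (\<lambda>_. c)"
proof -
  have "c \<le> \<bar>c\<bar> * (1 + ln (X i))" if "i \<in> S" for i
    using ln_scale_nonneg[OF that] mult_left_mono[of 1 "1 + ln (X i)" "\<bar>c\<bar>"] by linarith
  then show ?thesis
    unfolding log_bounded_def by (intro exI[of _ "\<bar>c\<bar>"]) auto
qed

lemma log_bounded_add:
  assumes "log_bounded g" "log_bounded h"
  shows "log_bounded (\<lambda>i. g i + h i)"
proof -
  obtain K K' where "K \<ge> 0" "\<And>i. i \<in> S \<Longrightarrow> g i \<le> K * (1 + ln (X i))"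
    and "K' \<ge> 0" "\<And>i. i \<in> S \<Longrightarrow> h i \<le> K' * (1 + ln (X i))"
    using assms unfolding log_bounded_def by blast
  then show ?thesis
    unfolding log_bounded_def
    by (intro exI[of _ "K + K'"]) (auto simp: distrib_right[of K K'] intro: add_mono)
qed

lemma log_bounded_cmult:
  assumes "log_bounded h" "c \<ge> 0"
  shows "log_bounded (\<lambda>i. c * h i)"
proof -
  obtain K where "K \<ge> 0" "\<And>i. i \<in> S \<Longrightarrow> h i \<le> K * (1 + ln (X i))"
    using assms unfolding log_bounded_def by blast
  with \<open>c \<ge> 0\<close> show ?thesis
    unfolding log_bounded_def
    by (intro exI[of _ "c * K"]) (auto simp: mult.assoc intro: mult_left_mono)
qed

lemma log_bounded_max:
  assumes "log_bounded g" "log_bounded h"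
  shows "log_bounded (\<lambda>i. max (g i) (h i))"
proof -
  obtain K K' where K: "K \<ge> 0" "\<And>i. i \<in> S \<Longrightarrow> g i \<le> K * (1 + ln (X i))"
    and K': "K' \<ge> 0" "\<And>i. i \<in> S \<Longrightarrow> h i \<le> K' * (1 + ln (X i))"
    using assms unfolding log_bounded_def by blast
  have "max (g i) (h i) \<le> max K K' * (1 + ln (X i))" if i: "i \<in> S" for i
  proof -
    have "K * (1 + ln (X i)) \<le> max K K' * (1 + ln (X i))" "K' * (1 + ln (X i)) \<le> max K K' * (1 + ln (X i))"
      using ln_scale_nonneg[OF i] by (intro mult_right_mono; simp)+
    with K(2)[OF i] K'(2)[OF i] show ?thesis
      by simp
  qed
  with K K' show ?thesis
    unfolding log_bounded_def by (intro exI[of _ "max K K'"]) auto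
qed

text \<open>A logarithm entering negatively needs a lower bound on its argument, expressed as a
  polynomial bound on the reciprocal.\<close>

lemma log_bounded_neg_ln:
  assumes "poly_bounded (\<lambda>i. 1 / h i)" "\<And>i. i \<in> S \<Longrightarrow> 0 < h i"
  shows "log_bounded (\<lambda>i. - 2 * ln (h i))"
proof -
  have "log_bounded (\<lambda>i. 2 * ln (1 / h i))"
    using assms by (intro log_bounded_cmult log_bounded_ln) auto
  then show ?thesis
  proof (rule log_bounded_mono)
    fix i assume "i \<in> S"
    then show "- 2 * ln (h i) \<le> 2 * ln (1 / h i)"
      using assms(2)[of i] by (simp add: ln_div)
  qed
qed

end

section \<open>Growth of the problem constants in the condition numbers\<close>

context
  fixes Lf B Lg Lg' Mg :: real
  assumes constants: "0 \<le> Lf" "0 \<le> B" "0 < Lg" "0 < Lg'" "0 \<le> Mg"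
begin

definition admissible :: "(real \<times> real) set" where
  "admissible = {(mug, mu). 0 < mug \<and> mug \<le> Lg \<and> 0 < mu \<and> mu \<le> const_L Lf B Lg' Mg mug}"

text \<open>The product of both condition numbers. Each is at least 1 and hence bounded by the
  product, whose logarithm splits into the two desired ones.\<close>

definition condition_scale :: "real \<times> real \<Rightarrow> real" where
  "condition_scale i = const_L Lf B Lg' Mg (fst i) / snd i * (Lg / fst i)"

interpretation growth_scale admissible condition_scale
proof
  fix i assume "i \<in> admissible"
  then have "1 \<le> const_L Lf B Lg' Mg (fst i) / snd i" "1 \<le> Lg / fst i"
    by (auto simp: admissible_def)
  then have "1 * 1 \<le> const_L Lf B Lg' Mg (fst i) / snd i * (Lg / fst i)"
    by (intro mult_mono) auto
  then show "1 \<le> condition_scale i"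
    by (simp add: condition_scale_def)
qed

lemma admissible_pos:
  assumes "i \<in> admissible"
  shows "0 < fst i" "fst i \<le> Lg" "0 < snd i" "snd i \<le> const_L Lf B Lg' Mg (fst i)"
    "0 < const_L Lf B Lg' Mg (fst i)"
  using assms by (auto simp: admissible_def)

lemma poly_bounded_recip_mug: "poly_bounded (\<lambda>i. 1 / fst i)"
proof -
  have "poly_bounded (\<lambda>i. 1 / Lg * condition_scale i)"
    by (intro poly_bounded_mult poly_bounded_const poly_bounded_scale)
  moreover have "\<bar>1 / fst i\<bar> \<le> \<bar>1 / Lg * condition_scale i\<bar>" if "i \<in> admissible" for i
  proof -
    have "1 / fst i * 1 \<le> 1 / fst i * (const_L Lf B Lg' Mg (fst i) / snd i)"
      using admissible_pos[OF that] by (intro mult_left_mono) auto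
    then show ?thesis
      using admissible_pos[OF that] constants by (simp add: condition_scale_def mult_ac)
  qed
  ultimately show ?thesis
    by (rule poly_bounded_mono)
qed

lemma poly_bounded_const_L: "poly_bounded (\<lambda>i. const_L Lf B Lg' Mg (fst i))"
  unfolding const_L_def by (intro poly_bounded_recip_mug poly_bounded_intros)

text \<open>If both quantities vanished, so would \<open>const_L\<close>, contrary to
  \<open>0 < mu \<le> const_L\<close>. This yields the lower bound on \<open>const_L\<close> and the
  positivity of \<open>const_Lz\<close>.\<close>

lemma const_L_degenerate: "i \<in> admissible \<Longrightarrow> 0 < Lf \<or> 0 < Mg * B"
proof (rule ccontr)
  assume i: "i \<in> admissible" and "\<not> (0 < Lf \<or> 0 < Mg * B)"
  then have "Lf = 0" "Mg * B = 0"
    using constants mult_nonneg_nonneg[of Mg B] by linarith+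
  then have "const_L Lf B Lg' Mg (fst i) = 0"
    by (auto simp: const_L_def)
  with admissible_pos[OF i] show False
    by simp
qed

text \<open>As \<open>const_L\<close> decreases in \<open>mug\<close>, it is bounded below by its value at the largest
  admissible \<open>mug\<close>, namely \<open>Lg\<close>.\<close>

lemma poly_bounded_recip_const_L: "poly_bounded (\<lambda>i. 1 / const_L Lf B Lg' Mg (fst i))"
proof (rule poly_bounded_mono[OF poly_bounded_const])
  fix i assume i: "i \<in> admissible"
  note pos = admissible_pos[OF i]
  have "Lf + Mg * B > 0"
    using const_L_degenerate[OF i] constants mult_nonneg_nonneg[of Mg B] by linarith
  then have "0 < Lf + Mg * B / Lg"
    using constants mult_nonneg_nonneg[of Mg B]
    by (cases "Lf = 0") (auto intro: add_pos_nonneg)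
  moreover have "0 \<le> Lg' * Mg * B / Lg\<^sup>2" "0 \<le> Lg' * Lf / Lg"
    using constants by auto
  ultimately have "0 < Lf + Lg' * Mg * B / Lg\<^sup>2 + (Lg' * Lf + Mg * B) / Lg"
    unfolding add_divide_distrib by linarith
  then have L0: "0 < const_L Lf B Lg' Mg Lg"
    using constants unfolding const_L_def by (intro mult_pos_pos) (auto intro: add_pos_pos)
  have "const_L Lf B Lg' Mg Lg \<le> const_L Lf B Lg' Mg (fst i)"
    unfolding const_L_def using pos constants
    by (intro mult_mono add_mono divide_left_mono power_mono) (auto intro!: add_nonneg_nonneg)
  with L0 show "\<bar>1 / const_L Lf B Lg' Mg (fst i)\<bar> \<le> \<bar>1 / const_L Lf B Lg' Mg Lg\<bar>"
    using pos by (simp add: divide_left_mono)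
qed

lemma poly_bounded_mu: "poly_bounded snd"
proof (rule poly_bounded_mono[OF poly_bounded_const_L])
  fix i assume "i \<in> admissible"
  then show "\<bar>snd i\<bar> \<le> \<bar>const_L Lf B Lg' Mg (fst i)\<bar>"
    using admissible_pos[of i] by simp
qed

text \<open>\<open>1 / mu\<close> is the outer condition number divided by \<open>const_L\<close>,
  so the lower bound on \<open>const_L\<close> enters.\<close>

lemma poly_bounded_recip_mu: "poly_bounded (\<lambda>i. 1 / snd i)"
proof -
  have "poly_bounded (\<lambda>i. condition_scale i * (1 / const_L Lf B Lg' Mg (fst i)))"
    by (intro poly_bounded_mult poly_bounded_scale poly_bounded_recip_const_L)
  moreover have "\<bar>1 / snd i\<bar> \<le> \<bar>condition_scale i * (1 / const_L Lf B Lg' Mg (fst i))\<bar>"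
    if "i \<in> admissible" for i
  proof -
    have "1 / snd i * 1 \<le> 1 / snd i * (Lg / fst i)"
      using admissible_pos[OF that] by (intro mult_left_mono) auto
    then show ?thesis
      using admissible_pos[OF that] constants by (simp add: condition_scale_def)
  qed
  ultimately show ?thesis
    by (rule poly_bounded_mono)
qed

lemma poly_bounded_const_Ly: "poly_bounded (\<lambda>i. const_Ly Lg' (fst i))"
  unfolding const_Ly_def by (intro poly_bounded_recip_mug poly_bounded_intros)

lemma poly_bounded_recip_const_Ly: "poly_bounded (\<lambda>i. 1 / const_Ly Lg' (fst i))"
proof (rule poly_bounded_mono[OF poly_bounded_const[of "Lg / Lg'"]])
  fix i assume "i \<in> admissible"
  then show "\<bar>1 / const_Ly Lg' (fst i)\<bar> \<le> \<bar>Lg / Lg'\<bar>"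
    using admissible_pos(1,2)[of i] constants by (simp add: const_Ly_def divide_right_mono)
qed

lemma poly_bounded_const_Lz: "poly_bounded (\<lambda>i. const_Lz Lf B Mg (fst i))"
  unfolding const_Lz_def by (intro poly_bounded_recip_mug poly_bounded_intros)

lemma poly_bounded_const_Lpsi: "poly_bounded (\<lambda>i. const_Lpsi Lf B Lg' Mg (fst i))"
  unfolding const_Lpsi_def
  by (intro poly_bounded_recip_mug poly_bounded_const_Lz poly_bounded_intros)

lemma const_Lpsi_pos: "Lg' \<le> const_Lpsi Lf B Lg' Mg mug" "0 < const_Lpsi Lf B Lg' Mg mug"
  using constants by (simp_all add: const_Lpsi_def)

lemma poly_bounded_recip_const_Lpsi: "poly_bounded (\<lambda>i. 1 / const_Lpsi Lf B Lg' Mg (fst i))"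
proof (rule poly_bounded_mono[OF poly_bounded_const[of "1 / Lg'"]])
  fix i
  show "\<bar>1 / const_Lpsi Lf B Lg' Mg (fst i)\<bar> \<le> \<bar>1 / Lg'\<bar>"
    using const_Lpsi_pos[of "fst i"] constants by (simp add: frac_le)
qed

lemma const_Lz_pos: "i \<in> admissible \<Longrightarrow> 0 < const_Lz Lf B Mg (fst i)"
  using const_L_degenerate[of i] admissible_pos(1)[of i] constants unfolding const_Lz_def
  by (auto intro: add_pos_nonneg add_nonneg_pos)

lemma const_Ly_pos: "i \<in> admissible \<Longrightarrow> 0 < const_Ly Lg' (fst i)"
  using admissible_pos(1)[of i] constants by (simp add: const_Ly_def)

lemmas poly_bounded_constants = poly_bounded_recip_mug poly_bounded_const_L
  poly_bounded_recip_const_L poly_bounded_mu poly_bounded_recip_mu poly_bounded_const_Ly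
  poly_bounded_recip_const_Ly poly_bounded_const_Lz poly_bounded_const_Lpsi
  poly_bounded_recip_const_Lpsi poly_bounded_intros

section \<open>The logarithms in the numbers of inner iterations\<close>

lemma poly_bounded_inverse_of_quotient:
  "poly_bounded (\<lambda>i. h i / g i) \<Longrightarrow> poly_bounded (\<lambda>i. 1 / (g i / h i))"
  by simp

lemma log_bounded_max_C: "log_bounded (\<lambda>i. max_C Lf B Lg' Mg (fst i) (snd i))"
proof -
  let ?Ly = "\<lambda>i. const_Ly Lg' (fst i)" and ?Lpsi = "\<lambda>i. const_Lpsi Lf B Lg' Mg (fst i)"
    and ?L = "\<lambda>i. const_L Lf B Lg' Mg (fst i)"
  have 1: "log_bounded (\<lambda>i. 1 + 2 * ln (6 + 24 * (?Lpsi i)\<^sup>2 / snd i))"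
    by (intro log_bounded_add log_bounded_const log_bounded_cmult log_bounded_ln
        poly_bounded_constants, rule add_pos_nonneg) (simp_all add: admissible_pos less_imp_le)
  have 2: "log_bounded (\<lambda>i. 2 * ln (1 + 4 * (?Ly i)\<^sup>2 / (?L i)\<^sup>2 * max (snd i) (8 * (2 * ?L i))))"
    by (intro log_bounded_cmult log_bounded_ln poly_bounded_constants)
      (rule add_pos_nonneg, simp_all add: admissible_pos less_imp_le le_max_iff_disj)
  have 3: "log_bounded (\<lambda>i. - 2 * ln (5 * (?Lpsi i)\<^sup>2 / snd i))"
    by (intro log_bounded_neg_ln poly_bounded_inverse_of_quotient poly_bounded_constants)
      (use const_Lpsi_pos in \<open>simp_all add: admissible_pos less_imp_neq[symmetric]\<close>)
  have 4: "log_bounded (\<lambda>i. - 2 * ln (?L i / (4 * (?Ly i)\<^sup>2)))"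
    by (intro log_bounded_neg_ln poly_bounded_inverse_of_quotient poly_bounded_constants)
      (simp add: admissible_pos const_Ly_pos less_imp_neq[symmetric])
  have "log_bounded (\<lambda>i. max (1 + 2 * ln (6 + 24 * (?Lpsi i)\<^sup>2 / snd i))
      (max (2 * ln (1 + 4 * (?Ly i)\<^sup>2 / (?L i)\<^sup>2 * max (snd i) (8 * (2 * ?L i))))
        (max 0 (max (- 2 * ln (5 * (?Lpsi i)\<^sup>2 / snd i)) (- 2 * ln (?L i / (4 * (?Ly i)\<^sup>2)))))))"
    by (intro log_bounded_max log_bounded_const 1 2 3 4)
  moreover have "Max {u, v, Max {0, w, x}} = max u (max v (max 0 (max w x)))" for u v w x :: real
    by simp
  ultimately show ?thesis
    unfolding max_C_def Let_def by (simp only:)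
qed

lemma log_bounded_max_C': "log_bounded (\<lambda>i. max_C' Lf B Lg' Mg (fst i) (snd i))"
proof -
  let ?Ly = "\<lambda>i. const_Ly Lg' (fst i)" and ?Lpsi = "\<lambda>i. const_Lpsi Lf B Lg' Mg (fst i)"
    and ?Lz = "\<lambda>i. const_Lz Lf B Mg (fst i)" and ?L = "\<lambda>i. const_L Lf B Lg' Mg (fst i)"
  have 1: "log_bounded (\<lambda>i. 1 + 2 * ln (4 + 24 * (?Lpsi i)\<^sup>2 / snd i))"
    by (intro log_bounded_add log_bounded_const log_bounded_cmult log_bounded_ln
        poly_bounded_constants, rule add_pos_nonneg) (simp_all add: admissible_pos less_imp_le)
  have 2: "log_bounded (\<lambda>i. 2 * ln (1 + 2 * (?Lz i)\<^sup>2 / (?Ly i)\<^sup>2 * (1 + 16 * (?Ly i)\<^sup>2)))"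
    by (intro log_bounded_cmult log_bounded_ln poly_bounded_constants)
      (rule add_pos_nonneg, simp_all)
  have 3: "log_bounded (\<lambda>i. - 2 * ln ((?Lpsi i)\<^sup>2 / (4 * (?Lz i)\<^sup>2 * snd i)))"
    by (intro log_bounded_neg_ln poly_bounded_inverse_of_quotient poly_bounded_constants)
      (use const_Lpsi_pos in \<open>simp_all add: admissible_pos const_Lz_pos less_imp_neq[symmetric]\<close>)
  have "log_bounded (\<lambda>i. - 2 * ln (Lg'\<^sup>2 / ?L i))"
    by (intro log_bounded_neg_ln poly_bounded_inverse_of_quotient poly_bounded_constants)
      (use constants in \<open>simp add: admissible_pos\<close>)
  then have 4: "log_bounded (\<lambda>i. - 2 * ln (1 / ?L i * Lg'\<^sup>2))"
    by simp
  have "log_bounded (\<lambda>i. max (1 + 2 * ln (4 + 24 * (?Lpsi i)\<^sup>2 / snd i))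
      (max (2 * ln (1 + 2 * (?Lz i)\<^sup>2 / (?Ly i)\<^sup>2 * (1 + 16 * (?Ly i)\<^sup>2)))
        (max 0 (max (- 2 * ln ((?Lpsi i)\<^sup>2 / (4 * (?Lz i)\<^sup>2 * snd i)))
          (- 2 * ln (1 / ?L i * Lg'\<^sup>2))))))"
    by (intro log_bounded_max log_bounded_const 1 2 3 4)
  moreover have "Max {u, v, Max {0, w, x}} = max u (max v (max 0 (max w x)))" for u v w x :: real
    by simp
  ultimately show ?thesis
    unfolding max_C'_def Let_def by (simp only:)
qed

lemma inner_iterations_bound:
  obtains K where "K > 0" "\<And>mug mu. (mug, mu) \<in> admissible \<Longrightarrow>
      let r = Lg / mug * (1 + ln (const_L Lf B Lg' Mg mug / mu) + ln (Lg / mug))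
      in 1 \<le> r \<and> real (num_T Lf B Lg Lg' Mg mug mu) \<le> K * r
        \<and> real (num_N Lf B Lg Lg' Mg mug mu) \<le> K * r"
proof -
  obtain K1 where K1: "K1 \<ge> 0" "\<And>i. i \<in> admissible \<Longrightarrow>
      max_C Lf B Lg' Mg (fst i) (snd i) \<le> K1 * (1 + ln (condition_scale i))"
    using log_bounded_max_C unfolding log_bounded_def by blast
  obtain K2 where K2: "K2 \<ge> 0" "\<And>i. i \<in> admissible \<Longrightarrow>
      max_C' Lf B Lg' Mg (fst i) (snd i) \<le> K2 * (1 + ln (condition_scale i))"
    using log_bounded_max_C' unfolding log_bounded_def by blast
  show thesis
  \<comment> \<open>The 4 is the prefactor of \<open>N\<close>; the final 1 pays for the rounding,
    because \<open>\<kappa> * l \<ge> 1\<close>.\<close>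
  proof (rule that[of "4 * (K1 + K2) + 1"])
    fix mug mu assume i: "(mug, mu) \<in> admissible"
    define \<kappa> where "\<kappa> = Lg / mug"
    define l where "l = 1 + ln (const_L Lf B Lg' Mg mug / mu) + ln \<kappa>"
    note pos = admissible_pos[OF i, simplified]
    have \<kappa>: "\<kappa> \<ge> 1"
      using pos by (simp add: \<kappa>_def)
    have scale: "1 + ln (condition_scale (mug, mu)) = l"
      unfolding condition_scale_def fst_conv snd_conv l_def \<kappa>_def
      by (subst ln_mult) (use pos constants in simp_all)
    have "l \<ge> 1"
      using ln_scale_nonneg[OF i] scale by linarith
    then have r: "\<kappa> * l \<ge> 1"
      using mult_mono[OF \<kappa> \<open>l \<ge> 1\<close>] \<kappa> by simp
    let ?C = "max_C Lf B Lg' Mg mug mu" and ?C' = "max_C' Lf B Lg' Mg mug mu"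
    have C: "?C \<le> K1 * l" "?C' \<le> K2 * l"
      using K1(2)[OF i] K2(2)[OF i] by (simp_all add: scale)
    have floor: "real (nat \<lfloor>y\<rfloor> + 1) \<le> y + 1" if "y \<ge> 0" for y :: real
      using that by simp
    have "real (num_T Lf B Lg Lg' Mg mug mu) \<le> \<kappa> * ?C + 1"
      unfolding num_T_def Let_def
      using floor[of "1 / (1 / Lg) * (1 / mug) * ?C"] pos constants max_C_nonneg
      by (simp add: \<kappa>_def)
    also have "\<dots> \<le> \<kappa> * (K1 * l) + \<kappa> * l"
      using C \<kappa> r by (intro add_mono mult_left_mono) auto
    also have "\<dots> = (K1 + 1) * (\<kappa> * l)"
      by (simp add: algebra_simps)
    also have "\<dots> \<le> (4 * (K1 + K2) + 1) * (\<kappa> * l)"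
      using r K1 K2 by (intro mult_right_mono) auto
    finally have T: "real (num_T Lf B Lg Lg' Mg mug mu) \<le> (4 * (K1 + K2) + 1) * (\<kappa> * l)" .
    have "real (num_N Lf B Lg Lg' Mg mug mu) \<le> 4 * \<kappa> * (?C + ?C') + 1"
      unfolding num_N_def Let_def
      using floor[of "2 * (1 / (1 / (2 * Lg))) * (1 / mug) * (?C + ?C')"] pos constants
        max_C_nonneg max_C'_nonneg
      by (simp add: \<kappa>_def)
    also have "\<dots> \<le> 4 * \<kappa> * (K1 * l + K2 * l) + \<kappa> * l"
      using C \<kappa> r by (intro add_mono mult_left_mono) auto
    also have "\<dots> = (4 * (K1 + K2) + 1) * (\<kappa> * l)"
      by (simp add: algebra_simps)
    finally have N: "real (num_N Lf B Lg Lg' Mg mug mu) \<le> (4 * (K1 + K2) + 1) * (\<kappa> * l)" .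
    show "let r = Lg / mug * (1 + ln (const_L Lf B Lg' Mg mug / mu) + ln (Lg / mug))
      in 1 \<le> r \<and> real (num_T Lf B Lg Lg' Mg mug mu) \<le> (4 * (K1 + K2) + 1) * r
        \<and> real (num_N Lf B Lg Lg' Mg mug mu) \<le> (4 * (K1 + K2) + 1) * r"
      using r T N by (simp add: l_def \<kappa>_def)
  qed (use K1 K2 in simp)
qed

end

text \<open>\<open>C\<close> is chosen before \<open>mug\<close> and \<open>mu\<close>, so it
  depends only on the fixed constants; \<open>logs\<close> makes the suppressed logarithms explicit,
  and the maximum with 1 covers an initial error already near or below
  \<open>\<epsilon>\<close>.\<close>

theorem corollary1:
  fixes Lf B Lg Lg' Mg :: real
  assumes "0 \<le> Lf" "0 \<le> B" "0 < Lg" "0 < Lg'" "0 \<le> Mg"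
  shows "\<exists>C>0. \<forall>mug mu :: real.
    let L = const_L Lf B Lg' Mg mug;
        T = num_T Lf B Lg Lg' Mg mug mu;
        N = num_N Lf B Lg Lg' Mg mug mu;
        kappa_g = Lg / mug;
        kappa_L = L / mu;
        logs = 1 + ln kappa_L + ln kappa_g
    in 0 < mug \<longrightarrow> mug \<le> Lg \<longrightarrow> 0 < mu \<longrightarrow> mu \<le> L \<longrightarrow>
       real T \<le> C * kappa_g * logs \<and> real N \<le> C * kappa_g * logs \<and>
       (\<forall>(f :: (real^'m) \<times> (real^'n) \<Rightarrow> real) g x0 ym zm.
          f differentiable_on UNIV \<longrightarrow> twice_differentiable g \<longrightarrow>
          assm_A1 g Lg mug \<longrightarrow> assm_A2 f Lf B \<longrightarrow> assm_A3 g Mg Lg' \<longrightarrow>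
          strongly_convex mu (outer_obj f g) \<longrightarrow>
          (\<forall>\<epsilon>>0. \<exists>k.
             (let x = fst (amigo f g (\<lambda>_. 1 / Lg) (\<lambda>_. 1 / (2 * Lg)) (\<lambda>_. 1 / L) T N x0 ym zm k);
                  xs = x_star f g;
                  log_err = max 1 (ln (E0_tot f g Lf B Lg Lg' Mg mug mu x0 ym zm / \<epsilon>))
              in outer_obj f g x - outer_obj f g xs + mu / 2 * (norm (x - xs))\<^sup>2 \<le> \<epsilon> \<and>
                 real k \<le> 8 * kappa_L * log_err \<and>
                 real (complexity T N 1 1 1 1 k) \<le> C * kappa_L * kappa_g * logs * log_err)))"
proof -
  obtain K where K: "K > 0" "\<And>mug mu. (mug, mu) \<in> admissible Lf B Lg Lg' Mg \<Longrightarrow>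
      let r = Lg / mug * (1 + ln (const_L Lf B Lg' Mg mug / mu) + ln (Lg / mug))
      in 1 \<le> r \<and> real (num_T Lf B Lg Lg' Mg mug mu) \<le> K * r
        \<and> real (num_N Lf B Lg Lg' Mg mug mu) \<le> K * r"
    using inner_iterations_bound[OF assms] by blast
  \<comment> \<open>This is \<open>8 * (2 * K + 2)\<close>: 8 from the outer iterations,
    \<open>2 * K\<close> for the two inner loops, 2 for the two remaining evaluations, absorbed by
    \<open>r \<ge> 1\<close>.\<close>
  define C where "C = 16 * K + 16"
  show ?thesis
    unfolding Let_def
  proof (intro exI[of _ C] conjI allI impI)
    show "C > 0"
      using K(1) by (simp add: C_def)
    fix mug mu :: real
    let ?L = "const_L Lf B Lg' Mg mug" and ?T = "num_T Lf B Lg Lg' Mg mug mu"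
      and ?N = "num_N Lf B Lg Lg' Mg mug mu"
    let ?logs = "1 + ln (?L / mu) + ln (Lg / mug)"
    assume range: "0 < mug" "mug \<le> Lg" "0 < mu" "mu \<le> ?L"
    define r where "r = Lg / mug * ?logs"
    have "(mug, mu) \<in> admissible Lf B Lg Lg' Mg"
      using range assms by (simp add: admissible_def)
    from K(2)[OF this] have r: "1 \<le> r" "real ?T \<le> K * r" "real ?N \<le> K * r"
      by (simp_all add: Let_def r_def)
    have "K * r \<le> C * r"
      using K(1) r(1) by (intro mult_right_mono) (auto simp: C_def)
    then show "real ?T \<le> C * (Lg / mug) * ?logs" "real ?N \<le> C * (Lg / mug) * ?logs"
      using r by (simp_all add: r_def mult.assoc)
    fix f g :: "(real^'m) \<times> (real^'n) \<Rightarrow> real" and x0 ym zm and \<epsilon> :: real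
    assume fg: "f differentiable_on UNIV" "twice_differentiable g" "assm_A1 g Lg mug"
      "assm_A2 f Lf B" "assm_A3 g Mg Lg'" "strongly_convex mu (outer_obj f g)" and \<epsilon>: "\<epsilon> > 0"
    interpret bilevel_strongly_convex f g Lf B Lg Lg' Mg mug mu
      by unfold_locales (use assms fg range in simp_all)
    let ?log_err = "max 1 (ln (E0_tot f g Lf B Lg Lg' Mg mug mu x0 ym zm / \<epsilon>))"
    obtain k x where k: "x = fst (iterate x0 ym zm k)"
      "F x - F (x_star f g) + mu / 2 * (norm (x - x_star f g))\<^sup>2 \<le> \<epsilon>"
      "real k \<le> 8 * (?L / mu) * ?log_err"
      using amigo_converges[OF \<epsilon>, of x0 ym zm] by blast
    have "real (complexity ?T ?N 1 1 1 1 k) = real k * (real ?T + real ?N + 2)"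
      by (simp add: complexity_def algebra_simps)
    also have "\<dots> \<le> (8 * (?L / mu) * ?log_err) * (K * r + K * r + 2 * r)"
      using k(3) r range by (intro mult_mono add_mono) auto
    also have "\<dots> = C * (?L / mu) * r * ?log_err"
    proof -
      have "(8 * u * e) * (K * r + K * r + 2 * r) = C * u * r * e" for u e
        by (simp add: C_def algebra_simps)
      then show ?thesis .
    qed
    also have "\<dots> = C * (?L / mu) * (Lg / mug) * ?logs * ?log_err"
      by (simp only: r_def mult.assoc)
    finally show "\<exists>k. outer_obj f g (fst (iterate x0 ym zm k)) - outer_obj f g (x_star f g)
        + mu / 2 * (norm (fst (iterate x0 ym zm k) - x_star f g))\<^sup>2 \<le> \<epsilon> \<and>
        real k \<le> 8 * (?L / mu) * ?log_err \<and>
        real (complexity ?T ?N 1 1 1 1 k) \<le> C * (?L / mu) * (Lg / mug) * ?logs * ?log_err"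
      using k by blast
  qed
qed

end
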